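(* The fundamental group of an algebraically clean graph of free groups is normally poly-free.
   Context: An algebraically clean graph of free groups is a graph of groups with finite underlying graph, whose vertex and edge groups are finite rank free groups, and all of whose edge maps $f_e:G_e\to G_{\tau(e)}$ are injections onto free factors. A group $G$ is poly-free if there is a chain of subgroups $1=G_0\unlhd G_1\unlhd\dots\unlhd G_n=G$ such that each $G_i/G_{i-1}$ is a free group (possibly of infinite rank); it is normally poly-free if moreover every $G_i$ is normal in $G$. *)

theory Defs
  imports "HOL-Algebra.Algebra"
begin

section \<open>Words, free bases, free groups\<close>

text \<open>A word over generators of type 'c is a list of letters (x, b); b = True means x,
  b = False means the inverse of x.\<close>

fun reduced_word :: "('c \<times> bool) list \<Rightarrow> bool" where
  "reduced_word ((x, b) # (y, c) # w) = (\<not> (x = y \<and> b \<noteq> c) \<and> reduced_word ((y, c) # w))"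
| "reduced_word _ = True"

definition cancel_letter :: "'c \<times> bool \<Rightarrow> ('c \<times> bool) list \<Rightarrow> ('c \<times> bool) list" where
  "cancel_letter l acc = (case acc of [] \<Rightarrow> [l]
      | m # acc' \<Rightarrow> (if fst l = fst m \<and> snd l \<noteq> snd m then acc' else l # acc))"

text \<open>Free reduction of a word (stack-based).\<close>
definition reduce_word :: "('c \<times> bool) list \<Rightarrow> ('c \<times> bool) list" where
  "reduce_word w = foldr cancel_letter w []"

text \<open>The free group on a set S of generators: reduced words, concatenation followed by
  reduction.\<close>
definition free_group_on :: "'c set \<Rightarrow> ('c \<times> bool) list monoid" where
  "free_group_on S = \<lparr> carrier = {w. reduced_word w \<and> fst ` set w \<subseteq> S},
                        monoid.mult = (\<lambda>u v. reduce_word (u @ v)),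
                        monoid.one = [] \<rparr>"

text \<open>Evaluation of a word over elements of a group.\<close>
definition eval_word :: "('c, 'm) monoid_scheme \<Rightarrow> ('c \<times> bool) list \<Rightarrow> 'c" where
  "eval_word H w = foldr (\<lambda>(x, b) acc. (if b then x else inv\<^bsub>H\<^esub> x) \<otimes>\<^bsub>H\<^esub> acc) w \<one>\<^bsub>H\<^esub>"

text \<open>B is a free basis of H: B generates H and no nonempty reduced word in B is trivial.\<close>
definition free_basis :: "('c, 'm) monoid_scheme \<Rightarrow> 'c set \<Rightarrow> bool" where
  "free_basis H B \<longleftrightarrow> B \<subseteq> carrier H \<and> generate H B = carrier H \<and>
     (\<forall>w. reduced_word w \<and> w \<noteq> [] \<and> fst ` set w \<subseteq> B \<longrightarrow> eval_word H w \<noteq> \<one>\<^bsub>H\<^esub>)"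

text \<open>Free group (possibly of infinite rank).\<close>
definition is_free_group :: "('c, 'm) monoid_scheme \<Rightarrow> bool" where
  "is_free_group H \<longleftrightarrow> group H \<and> (\<exists>B. free_basis H B)"

text \<open>Free group of finite rank.\<close>
definition is_fin_rank_free_group :: "('c, 'm) monoid_scheme \<Rightarrow> bool" where
  "is_fin_rank_free_group H \<longleftrightarrow> group H \<and> (\<exists>B. finite B \<and> free_basis H B)"

section \<open>Free factors\<close>

text \<open>G is the internal free product of its subgroups H and K: H \<inter> K trivial, H \<union> K
  generates G, and every nonempty alternating product of nontrivial elements is nontrivial.\<close>
definition alternating_word :: "('c, 'm) monoid_scheme \<Rightarrow> 'c set \<Rightarrow> 'c set \<Rightarrow> 'c list \<Rightarrow> bool" where
  "alternating_word G H K xs \<longleftrightarrow> xs \<noteq> [] \<and> (\<forall>x\<in>set xs. x \<in> (H \<union> K) - {\<one>\<^bsub>G\<^esub>}) \<and>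
     (\<forall>i. Suc i < length xs \<longrightarrow>
        \<not> (xs ! i \<in> H \<and> xs ! Suc i \<in> H) \<and> \<not> (xs ! i \<in> K \<and> xs ! Suc i \<in> K))"

definition internal_free_product :: "('c, 'm) monoid_scheme \<Rightarrow> 'c set \<Rightarrow> 'c set \<Rightarrow> bool" where
  "internal_free_product G H K \<longleftrightarrow> subgroup H G \<and> subgroup K G \<and> H \<inter> K = {\<one>\<^bsub>G\<^esub>} \<and>
     generate G (H \<union> K) = carrier G \<and>
     (\<forall>xs. alternating_word G H K xs \<longrightarrow> foldr (\<otimes>\<^bsub>G\<^esub>) xs \<one>\<^bsub>G\<^esub> \<noteq> \<one>\<^bsub>G\<^esub>)"

definition free_factor :: "'c set \<Rightarrow> ('c, 'm) monoid_scheme \<Rightarrow> bool" where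
  "free_factor H G \<longleftrightarrow> (\<exists>K. internal_free_product G H K)"

section \<open>Graphs\<close>

text \<open>Finite oriented graph: vertices V, edges E, origin o and terminus t. Undirected
  connectivity of V using the edges in S.\<close>
definition graph_connected :: "'v set \<Rightarrow> 'e set \<Rightarrow> ('e \<Rightarrow> 'v) \<Rightarrow> ('e \<Rightarrow> 'v) \<Rightarrow> bool" where
  "graph_connected V S o' t \<longleftrightarrow>
     (\<forall>u\<in>V. \<forall>w\<in>V. (u, w) \<in> ({(o' e, t e) | e. e \<in> S} \<union> {(t e, o' e) | e. e \<in> S})\<^sup>*)"

text \<open>T is a spanning tree of the finite connected graph (V,E): a connected spanning
  subgraph with |T| = |V| - 1 edges.\<close>
definition spanning_tree :: "'v set \<Rightarrow> 'e set \<Rightarrow> ('e \<Rightarrow> 'v) \<Rightarrow> ('e \<Rightarrow> 'v) \<Rightarrow> 'e set \<Rightarrow> bool" where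
  "spanning_tree V E o' t T \<longleftrightarrow> T \<subseteq> E \<and> graph_connected V T o' t \<and> card T + 1 = card V"

section \<open>Graphs of groups\<close>

text \<open>Graph of groups: vertex groups Gv, edge groups Ge, edge maps alpha e : Ge e \<rightarrow> Gv (o e)
  and omega e : Ge e \<rightarrow> Gv (t e) (one edge per geometric edge; the two maps are f_e, f_{\bar e}).\<close>
definition alg_clean_graph_of_free_groups ::
  "'v set \<Rightarrow> 'e set \<Rightarrow> ('e \<Rightarrow> 'v) \<Rightarrow> ('e \<Rightarrow> 'v) \<Rightarrow> ('v \<Rightarrow> 'a monoid) \<Rightarrow> ('e \<Rightarrow> 'b monoid)
     \<Rightarrow> ('e \<Rightarrow> 'b \<Rightarrow> 'a) \<Rightarrow> ('e \<Rightarrow> 'b \<Rightarrow> 'a) \<Rightarrow> bool" where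
  "alg_clean_graph_of_free_groups V E o' t Gv Ge \<alpha> \<omega> \<longleftrightarrow>
     finite V \<and> finite E \<and> o' ` E \<subseteq> V \<and> t ` E \<subseteq> V \<and> graph_connected V E o' t \<and>
     (\<forall>v\<in>V. is_fin_rank_free_group (Gv v)) \<and>
     (\<forall>e\<in>E. is_fin_rank_free_group (Ge e)) \<and>
     (\<forall>e\<in>E. \<alpha> e \<in> hom (Ge e) (Gv (o' e)) \<and> inj_on (\<alpha> e) (carrier (Ge e)) \<and>
              free_factor (\<alpha> e ` carrier (Ge e)) (Gv (o' e))) \<and>
     (\<forall>e\<in>E. \<omega> e \<in> hom (Ge e) (Gv (t e)) \<and> inj_on (\<omega> e) (carrier (Ge e)) \<and>
              free_factor (\<omega> e ` carrier (Ge e)) (Gv (t e)))"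

text \<open>Normal closure of a set R in a group F.\<close>
definition normal_closure :: "('c, 'm) monoid_scheme \<Rightarrow> 'c set \<Rightarrow> 'c set" where
  "normal_closure F R = generate F {g \<otimes>\<^bsub>F\<^esub> r \<otimes>\<^bsub>F\<^esub> inv\<^bsub>F\<^esub> g | g r. g \<in> carrier F \<and> r \<in> R}"

type_synonym ('v, 'a, 'e) gog_gen = "('v \<times> 'a) + 'e"

definition gog_generators :: "'v set \<Rightarrow> 'e set \<Rightarrow> ('v \<Rightarrow> 'a monoid) \<Rightarrow> ('v, 'a, 'e) gog_gen set" where
  "gog_generators V E Gv = {Inl (v, g) | v g. v \<in> V \<and> g \<in> carrier (Gv v)} \<union> Inr ` E"

text \<open>Relators of the standard presentation of \<pi>1 relative to the maximal tree T:
  multiplication tables of the vertex groups, t_e omega_e(a) t_e^-1 = alpha_e(a), and t_e = 1 for e in T.\<close>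
definition gog_relators ::
  "'v set \<Rightarrow> 'e set \<Rightarrow> ('e \<Rightarrow> 'v) \<Rightarrow> ('e \<Rightarrow> 'v) \<Rightarrow> ('v \<Rightarrow> 'a monoid) \<Rightarrow> ('e \<Rightarrow> 'b monoid)
     \<Rightarrow> ('e \<Rightarrow> 'b \<Rightarrow> 'a) \<Rightarrow> ('e \<Rightarrow> 'b \<Rightarrow> 'a) \<Rightarrow> 'e set \<Rightarrow> (('v, 'a, 'e) gog_gen \<times> bool) list set" where
  "gog_relators V E o' t Gv Ge \<alpha> \<omega> T =
     {reduce_word [(Inl (v, g), True), (Inl (v, h), True), (Inl (v, g \<otimes>\<^bsub>Gv v\<^esub> h), False)]
        | v g h. v \<in> V \<and> g \<in> carrier (Gv v) \<and> h \<in> carrier (Gv v)}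
   \<union> {reduce_word [(Inr e, True), (Inl (t e, \<omega> e a), True), (Inr e, False), (Inl (o' e, \<alpha> e a), False)]
        | e a. e \<in> E \<and> a \<in> carrier (Ge e)}
   \<union> {[(Inr e, True)] | e. e \<in> T}"

text \<open>The fundamental group of the graph of groups (computed with respect to the maximal tree T).\<close>
definition gog_fundamental_group ::
  "'v set \<Rightarrow> 'e set \<Rightarrow> ('e \<Rightarrow> 'v) \<Rightarrow> ('e \<Rightarrow> 'v) \<Rightarrow> ('v \<Rightarrow> 'a monoid) \<Rightarrow> ('e \<Rightarrow> 'b monoid)
     \<Rightarrow> ('e \<Rightarrow> 'b \<Rightarrow> 'a) \<Rightarrow> ('e \<Rightarrow> 'b \<Rightarrow> 'a) \<Rightarrow> 'e set
     \<Rightarrow> (('v, 'a, 'e) gog_gen \<times> bool) list set monoid" where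
  "gog_fundamental_group V E o' t Gv Ge \<alpha> \<omega> T =
     (let F = free_group_on (gog_generators V E Gv)
      in F Mod (normal_closure F (gog_relators V E o' t Gv Ge \<alpha> \<omega> T)))"

section \<open>Poly-free groups\<close>

definition poly_free :: "('c, 'm) monoid_scheme \<Rightarrow> bool" where
  "poly_free G \<longleftrightarrow> group G \<and> (\<exists>(N :: nat \<Rightarrow> 'c set) n.
     N 0 = {\<one>\<^bsub>G\<^esub>} \<and> N n = carrier G \<and>
     (\<forall>i\<le>n. subgroup (N i) G) \<and>
     (\<forall>i<n. normal (N i) (G\<lparr>carrier := N (Suc i)\<rparr>) \<and>
            is_free_group ((G\<lparr>carrier := N (Suc i)\<rparr>) Mod (N i))))"

definition normally_poly_free :: "('c, 'm) monoid_scheme \<Rightarrow> bool" where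
  "normally_poly_free G \<longleftrightarrow> group G \<and> (\<exists>(N :: nat \<Rightarrow> 'c set) n.
     N 0 = {\<one>\<^bsub>G\<^esub>} \<and> N n = carrier G \<and>
     (\<forall>i\<le>n. normal (N i) G) \<and>
     (\<forall>i<n. normal (N i) (G\<lparr>carrier := N (Suc i)\<rparr>) \<and>
            is_free_group ((G\<lparr>carrier := N (Suc i)\<rparr>) Mod (N i))))"

end

theory Submission
  imports Defs
begin

text \<open>
  Killing the vertex groups retracts the fundamental group \<open>G\<close> onto the free group \<open>Q\<close> on the edges
  outside the spanning tree, and the kernel \<open>N\<close> is the fundamental group of a tree of free groups
  over the universal cover of the underlying graph, whose vertex set is \<open>V \<times> Q\<close>. Each edge group is
  a free factor of the adjacent vertex group farther from the root, so adding one vertex group at a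
  time only adds a free complement: \<open>N\<close> is the free product of the root group and of all these
  complements, which are free by the Nielsen--Schreier theorem. Hence \<open>1 \<le> N \<le> G\<close> is the required
  chain.

  Both here and for Nielsen--Schreier, freeness is detected by letting the group act on the product of
  a set of cosets with the free group \<open>F\<close> on the candidate basis, in such a way that each candidate
  moves a point over the base coset exactly as the corresponding generator moves it by left translation
  in \<open>F\<close>.
\<close>

section \<open>Words and free groups\<close>

text \<open>The shape of the construction comes from orienting every edge of the cover away from the
  root. An edge outside the spanning tree is then crossed forwards in some copies and backwards in
  others, so the free factor condition is used at both of its ends.

  The presentation only provides maps out of the group. It does not show directly that vertex groups
  embed, nor which relations hold among their conjugates. Freeness of the kernel is therefore
  certified from outside. Each conjugate of a vertex group is mapped to the candidate free group, by
  recursion along the tree: on the edge group the map is forced by the parent, and on the complement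
  it is chosen to produce new letters. These maps satisfy the edge relations, and so they assemble
  into an action of the whole group.

  An action of this kind shows independence only. Generation is a separate argument, in both places
  a Reidemeister-Schreier rewriting: with the transversal read off from a tree in the Schreier graph
  for subgroups of free groups, and with a section of the retraction for the kernel.\<close>

definition inv_letter :: "'c \<times> bool \<Rightarrow> 'c \<times> bool" where
  "inv_letter l = (fst l, \<not> snd l)"

lemma inv_letter_simps [simp]:
  "inv_letter (x, b) = (x, \<not> b)" "fst (inv_letter l) = fst l" "snd (inv_letter l) = (\<not> snd l)"
  "inv_letter (inv_letter l) = l"
  by (simp_all add: inv_letter_def)

lemma inv_letter_iff: "l = inv_letter m \<longleftrightarrow> fst l = fst m \<and> snd l \<noteq> snd m"
  by (cases l; cases m) auto

lemma cancel_letter_Cons: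
  "cancel_letter l (m # w) = (if l = inv_letter m then w else l # m # w)"
  by (simp add: cancel_letter_def inv_letter_iff)

lemma cancel_letter_Nil [simp]: "cancel_letter l [] = [l]"
  by (simp add: cancel_letter_def)

lemma reduced_word_Cons2:
  "reduced_word (l # m # w) \<longleftrightarrow> l \<noteq> inv_letter m \<and> reduced_word (m # w)"
  by (cases l; cases m) auto

lemma reduced_word_ConsD: "reduced_word (l # w) \<Longrightarrow> reduced_word w"
  by (cases w) (auto simp: reduced_word_Cons2)

lemma reduced_word_appendD: "reduced_word (u @ v) \<Longrightarrow> reduced_word u \<and> reduced_word v"
proof (induction u)
  case (Cons l u)
  then show ?case
    using reduced_word_ConsD[of l "u @ v"]
    by (cases u) (auto simp: reduced_word_Cons2)
qed simp

text \<open>\<open>reduced_word\<close> recurses from the front, whereas paths in the cover grow at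
  their far end.\<close>

lemma reduced_word_snoc:
  "reduced_word (u @ [l]) \<longleftrightarrow> reduced_word u \<and> (u = [] \<or> last u \<noteq> inv_letter l)"
proof (induction u)
  case (Cons m u)
  then show ?case by (cases u) (auto simp: reduced_word_Cons2)
qed simp

lemma reduced_word_cancel_letter: "reduced_word w \<Longrightarrow> reduced_word (cancel_letter l w)"
  by (cases w) (auto simp: cancel_letter_Cons reduced_word_Cons2 dest: reduced_word_ConsD)

lemma cancel_letter_reduced: "reduced_word (l # w) \<Longrightarrow> cancel_letter l w = l # w"
  by (cases w) (auto simp: cancel_letter_Cons reduced_word_Cons2)

text \<open>Letters act on reduced words by permutations, with inverse letters acting inversely.
  This is van der Waerden's device: it yields associativity of the reduced product without
  confluence of cancellation.\<close>

lemma cancel_letter_inv_letter: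
  "reduced_word w \<Longrightarrow> cancel_letter (inv_letter l) (cancel_letter l w) = w"
  by (cases w)
    (auto simp: cancel_letter_Cons reduced_word_Cons2 dest: reduced_word_ConsD intro: cancel_letter_reduced)

lemma set_cancel_letter: "set (cancel_letter l w) \<subseteq> insert l (set w)"
  by (cases w) (auto simp: cancel_letter_Cons)

lemma reduced_word_foldr: "reduced_word v \<Longrightarrow> reduced_word (foldr cancel_letter u v)"
  by (induction u) (auto intro: reduced_word_cancel_letter)

lemma reduced_word_reduce_word: "reduced_word (reduce_word w)"
  unfolding reduce_word_def by (rule reduced_word_foldr) simp

lemma set_reduce_word: "set (reduce_word w) \<subseteq> set w"
  unfolding reduce_word_def using set_cancel_letter by (induction w) fastforce+

lemma reduce_word_reduced: "reduced_word w \<Longrightarrow> reduce_word w = w"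
proof (induction w)
  case (Cons l w)
  then show ?case
    using reduced_word_ConsD[OF Cons.prems] cancel_letter_reduced[OF Cons.prems]
    by (simp add: reduce_word_def)
qed (simp add: reduce_word_def)

text \<open>Cancelling a pair inside the acting word changes nothing, since the two letters act as
  mutually inverse permutations.\<close>

lemma foldr_cancel_letter:
  assumes "reduced_word v"
  shows "foldr cancel_letter (cancel_letter l u) v = cancel_letter l (foldr cancel_letter u v)"
proof (cases u)
  case (Cons m u')
  have "reduced_word (foldr cancel_letter u' v)"
    by (rule reduced_word_foldr[OF assms])
  then show ?thesis
    by (simp add: Cons cancel_letter_Cons cancel_letter_inv_letter)
qed simp

lemma foldr_cancel_reduce_word:
  "reduced_word v \<Longrightarrow> foldr cancel_letter (reduce_word u) v = foldr cancel_letter u v"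
  by (induction u) (auto simp: reduce_word_def foldr_cancel_letter)

lemma reduce_word_append: "reduce_word (u @ v) = foldr cancel_letter u (reduce_word v)"
  by (simp add: reduce_word_def)

lemma reduce_word_append_left: "reduce_word (reduce_word u @ v) = reduce_word (u @ v)"
  by (simp add: reduce_word_append foldr_cancel_reduce_word reduced_word_reduce_word)

lemma reduce_word_append_right: "reduce_word (u @ reduce_word v) = reduce_word (u @ v)"
  by (simp add: reduce_word_append reduce_word_reduced reduced_word_reduce_word)

lemma reduce_word_inverse: "reduce_word (rev (map inv_letter w) @ w) = []"
proof (induction w)
  case (Cons l w)
  have "reduce_word (rev (map inv_letter (l # w)) @ l # w)
      = foldr cancel_letter (rev (map inv_letter w))
          (cancel_letter (inv_letter l) (cancel_letter l (reduce_word w)))"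
    by (simp add: reduce_word_def)
  also have "\<dots> = reduce_word (rev (map inv_letter w) @ w)"
    by (simp only: cancel_letter_inv_letter[OF reduced_word_reduce_word] reduce_word_append)
  finally show ?case using Cons by simp
qed (simp add: reduce_word_def)

lemma carrier_free_group_on: "w \<in> carrier (free_group_on S) \<longleftrightarrow> reduced_word w \<and> fst ` set w \<subseteq> S"
  and mult_free_group_on: "u \<otimes>\<^bsub>free_group_on S\<^esub> v = reduce_word (u @ v)"
  and one_free_group_on: "\<one>\<^bsub>free_group_on S\<^esub> = []"
  by (simp_all add: free_group_on_def)

lemma singleton_in_free_group_on [simp]: "[(x, b)] \<in> carrier (free_group_on S) \<longleftrightarrow> x \<in> S"
  by (simp add: carrier_free_group_on)

lemma reduce_word_in_free_group_on:
  "fst ` set w \<subseteq> S \<Longrightarrow> reduce_word w \<in> carrier (free_group_on S)"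
  using set_reduce_word[of w] by (auto simp: carrier_free_group_on reduced_word_reduce_word)

lemma group_free_group_on: "group (free_group_on S)"
proof (rule groupI)
  let ?F = "free_group_on S"
  show "x \<otimes>\<^bsub>?F\<^esub> y \<in> carrier ?F" if "x \<in> carrier ?F" "y \<in> carrier ?F" for x y
    unfolding mult_free_group_on using that
    by (intro reduce_word_in_free_group_on) (auto simp: carrier_free_group_on)
  show "\<one>\<^bsub>?F\<^esub> \<in> carrier ?F"
    by (simp add: carrier_free_group_on one_free_group_on)
  show "x \<otimes>\<^bsub>?F\<^esub> y \<otimes>\<^bsub>?F\<^esub> z = x \<otimes>\<^bsub>?F\<^esub> (y \<otimes>\<^bsub>?F\<^esub> z)" for x y z
    by (simp add: mult_free_group_on reduce_word_append_left reduce_word_append_right)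
  show "\<one>\<^bsub>?F\<^esub> \<otimes>\<^bsub>?F\<^esub> x = x" if "x \<in> carrier ?F" for x
    using that by (simp add: carrier_free_group_on mult_free_group_on one_free_group_on reduce_word_reduced)
  show "\<exists>y\<in>carrier ?F. y \<otimes>\<^bsub>?F\<^esub> x = \<one>\<^bsub>?F\<^esub>" if "x \<in> carrier ?F" for x
  proof
    let ?y = "reduce_word (rev (map inv_letter x))"
    show "?y \<in> carrier ?F"
      using that by (intro reduce_word_in_free_group_on) (auto simp: carrier_free_group_on)
    show "?y \<otimes>\<^bsub>?F\<^esub> x = \<one>\<^bsub>?F\<^esub>"
      by (simp add: mult_free_group_on one_free_group_on reduce_word_append_left reduce_word_inverse)
  qed
qed

lemma inv_singleton_free_group_on:
  assumes "x \<in> S"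
  shows "inv\<^bsub>free_group_on S\<^esub> [(x, b)] = [(x, \<not> b)]"
  by (rule group.inv_equality[OF group_free_group_on])
    (use assms in \<open>simp_all add: mult_free_group_on one_free_group_on reduce_word_def cancel_letter_Cons\<close>)

section \<open>Homomorphisms out of a free group\<close>

definition letter_value :: "('h, 'm) monoid_scheme \<Rightarrow> ('c \<Rightarrow> 'h) \<Rightarrow> 'c \<times> bool \<Rightarrow> 'h" where
  "letter_value H f l = (if snd l then f (fst l) else inv\<^bsub>H\<^esub> f (fst l))"

text \<open>The map on words induced by \<open>f\<close>, obtained by relabelling so that
  \<open>eval_word\<close> is the case of the identity. Letters may come from any index type and
  \<open>f\<close> may fail to be injective.\<close>

definition lift_word :: "('h, 'm) monoid_scheme \<Rightarrow> ('c \<Rightarrow> 'h) \<Rightarrow> ('c \<times> bool) list \<Rightarrow> 'h" where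
  "lift_word H f w = eval_word H (map (apfst f) w)"

lemma lift_word_Nil [simp]: "lift_word H f [] = \<one>\<^bsub>H\<^esub>"
  by (simp add: lift_word_def eval_word_def)

lemma lift_word_Cons [simp]: "lift_word H f (l # w) = letter_value H f l \<otimes>\<^bsub>H\<^esub> lift_word H f w"
  by (cases l) (simp add: lift_word_def eval_word_def letter_value_def)

lemma lift_word_id: "lift_word H (\<lambda>x. x) w = eval_word H w"
  by (simp add: lift_word_def apfst_def map_prod_def)

lemma lift_word_cong:
  assumes "\<And>x. x \<in> fst ` set w \<Longrightarrow> f x = g x"
  shows "lift_word H f w = lift_word H g w"
  using assms by (induction w) (auto simp: letter_value_def)

lemma (in group) letter_value_closed:
  "f \<in> S \<rightarrow> carrier G \<Longrightarrow> fst l \<in> S \<Longrightarrow> letter_value G f l \<in> carrier G"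
  by (auto simp: letter_value_def)

lemma (in group) lift_word_closed:
  "f \<in> S \<rightarrow> carrier G \<Longrightarrow> fst ` set w \<subseteq> S \<Longrightarrow> lift_word G f w \<in> carrier G"
  by (induction w) (auto intro: letter_value_closed)

lemma (in group) lift_word_singleton:
  "f x \<in> carrier G \<Longrightarrow> lift_word G f [(x, True)] = f x"
  by (simp add: letter_value_def)

lemma (in group) lift_word_append:
  assumes "f \<in> S \<rightarrow> carrier G" "fst ` set u \<subseteq> S" "fst ` set v \<subseteq> S"
  shows "lift_word G f (u @ v) = lift_word G f u \<otimes> lift_word G f v"
  using assms
proof (induction u)
  case Nil
  then show ?case by (simp add: lift_word_closed[of f S])
next
  case (Cons l u)
  then show ?case
    by (simp add: m_assoc lift_word_closed[of f S] letter_value_closed[of f S])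
qed

lemma (in group) lift_word_cancel_letter:
  assumes "f \<in> S \<rightarrow> carrier G" "fst l \<in> S" "fst ` set w \<subseteq> S"
  shows "lift_word G f (cancel_letter l w) = letter_value G f l \<otimes> lift_word G f w"
proof (cases w)
  case (Cons m w')
  have "letter_value G f (inv_letter m) \<otimes> (letter_value G f m \<otimes> x) = x" if "x \<in> carrier G" for x
  proof -
    have "f (fst m) \<in> carrier G"
      using assms Cons by auto
    then show ?thesis
      using that by (auto simp: letter_value_def inv_solve_left simp flip: m_assoc)
  qed
  then show ?thesis
    using assms by (simp add: Cons cancel_letter_Cons lift_word_closed[of f S])
qed simp

lemma (in group) lift_word_reduce_word:
  assumes "f \<in> S \<rightarrow> carrier G" "fst ` set w \<subseteq> S"
  shows "lift_word G f (reduce_word w) = lift_word G f w"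
  using assms
proof (induction w)
  case (Cons l w)
  have "fst ` set (reduce_word w) \<subseteq> S"
    using Cons.prems set_reduce_word[of w] by auto
  then show ?case
    using Cons lift_word_cancel_letter[of f S l "reduce_word w"] by (simp add: reduce_word_def)
qed (simp add: reduce_word_def)

lemma (in group) lift_word_hom:
  assumes "f \<in> S \<rightarrow> carrier G"
  shows "lift_word G f \<in> hom (free_group_on S) G"
proof (rule homI)
  fix u v assume "u \<in> carrier (free_group_on S)" "v \<in> carrier (free_group_on S)"
  then show "lift_word G f (u \<otimes>\<^bsub>free_group_on S\<^esub> v) = lift_word G f u \<otimes> lift_word G f v"
    using lift_word_append[OF assms, of u v] lift_word_reduce_word[OF assms, of "u @ v"]
    by (simp add: carrier_free_group_on mult_free_group_on image_Un)
qed (use lift_word_closed[OF assms] in \<open>auto simp: carrier_free_group_on\<close>)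

lemma (in group) lift_word_image:
  assumes f: "f \<in> S \<rightarrow> carrier G"
  shows "lift_word G f ` carrier (free_group_on S) = generate G (f ` S)"
proof
  have "lift_word G f w \<in> generate G (f ` S)" if "fst ` set w \<subseteq> S" for w
    using that
  proof (induction w)
    case (Cons l w)
    then have "letter_value G f l \<in> generate G (f ` S)"
      by (auto simp: letter_value_def intro: generate.incl generate.inv)
    then show ?case
      using Cons by (simp add: generate.eng)
  qed (simp add: generate.one)
  then show "lift_word G f ` carrier (free_group_on S) \<subseteq> generate G (f ` S)"
    by (auto simp: carrier_free_group_on)
  interpret h: group_hom "free_group_on S" G "lift_word G f"
    by (simp add: group_hom_def group_hom_axioms_def group_free_group_on lift_word_hom[OF f])
  have "f x = lift_word G f [(x, True)]" if "x \<in> S" for x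
    using f that by (intro lift_word_singleton[symmetric]) auto
  then have "f ` S \<subseteq> lift_word G f ` carrier (free_group_on S)"
    by fastforce
  then show "generate G (f ` S) \<subseteq> lift_word G f ` carrier (free_group_on S)"
    by (intro generate_subgroup_incl h.img_is_subgroup)
qed

lemma lift_word_free_group_on:
  assumes "fst ` set w \<subseteq> S"
  shows "lift_word (free_group_on S) (\<lambda>x. [(x, True)]) w = reduce_word w"
  using assms
proof (induction w)
  case (Cons l w)
  have "letter_value (free_group_on S) (\<lambda>x. [(x, True)]) l = [l]"
    using Cons.prems by (cases l) (auto simp: letter_value_def inv_singleton_free_group_on)
  then show ?case
    using Cons reduce_word_append_right[of "[l]" w] by (simp add: mult_free_group_on)
qed (simp add: one_free_group_on reduce_word_def)

section \<open>Free bases\<close>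

lemma reduced_word_map:
  assumes "inj_on f A" "fst ` set w \<subseteq> A"
  shows "reduced_word (map (apfst f) w) \<longleftrightarrow> reduced_word w"
  using assms(2)
proof (induction w rule: reduced_word.induct)
  case (1 x b y c w)
  then show ?case using inj_onD[OF assms(1), of x y] by auto
qed auto

text \<open>Candidate bases arise as indexed families, and the indices serve as letters before the
  elements are known to be distinct. Injectivity comes for free: if \<open>f x = f y\<close> with
  \<open>x \<noteq> y\<close>, the reduced word of \<open>x\<close> followed by the inverse of
  \<open>y\<close> would evaluate to the identity.\<close>

lemma (in group) free_basis_image:
  assumes f: "f \<in> Y \<rightarrow> carrier G" and gen: "generate G (f ` Y) = carrier G"
    and nontriv: "\<And>w. \<lbrakk>reduced_word w; w \<noteq> []; fst ` set w \<subseteq> Y\<rbrakk> \<Longrightarrow> lift_word G f w \<noteq> \<one>"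
  shows "free_basis G (f ` Y)"
  unfolding free_basis_def
proof (intro conjI allI impI)
  show "f ` Y \<subseteq> carrier G" using f by auto
  have "inj_on f Y"
  proof (rule inj_onI, rule ccontr)
    fix x y assume "x \<in> Y" "y \<in> Y" "f x = f y" "x \<noteq> y"
    moreover have "f y \<in> carrier G" using f \<open>y \<in> Y\<close> by auto
    ultimately show False
      using nontriv[of "[(x, True), (y, False)]"] by (simp add: letter_value_def)
  qed
  fix w assume w: "reduced_word w \<and> w \<noteq> [] \<and> fst ` set w \<subseteq> f ` Y"
  define g where "g = inv_into Y f"
  have w_eq: "map (apfst f) (map (apfst g) w) = w"
  proof -
    have "f (g (fst l)) = fst l" if "l \<in> set w" for l
      unfolding g_def using w that by (intro f_inv_into_f) auto
    then show ?thesis by (auto intro!: map_idI simp: prod_eq_iff)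
  qed
  have sub: "fst ` set (map (apfst g) w) \<subseteq> Y"
    using w by (auto simp: g_def image_subset_iff intro!: inv_into_into)
  have "lift_word G f (map (apfst g) w) \<noteq> \<one>"
    using w reduced_word_map[OF \<open>inj_on f Y\<close> sub] sub by (intro nontriv) (auto simp only: w_eq map_is_Nil_conv)
  then show "eval_word G w \<noteq> \<one>"
    unfolding lift_word_def w_eq .
qed (rule gen)

lemma free_basis_free_group_on: "free_basis (free_group_on S) ((\<lambda>x. [(x, True)]) ` S)"
proof -
  interpret F: group "free_group_on S" by (rule group_free_group_on)
  let ?i = "\<lambda>x. [(x, True)]"
  have i: "?i \<in> S \<rightarrow> carrier (free_group_on S)" by auto
  show ?thesis
  proof (rule F.free_basis_image[OF i])
    have "lift_word (free_group_on S) ?i ` carrier (free_group_on S) = (\<lambda>w. w) ` carrier (free_group_on S)"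
      by (intro image_cong) (auto simp: carrier_free_group_on lift_word_free_group_on reduce_word_reduced)
    then show "generate (free_group_on S) (?i ` S) = carrier (free_group_on S)"
      using F.lift_word_image[OF i] by simp
  qed (auto simp: lift_word_free_group_on reduce_word_reduced one_free_group_on)
qed

lemma (in group_hom) lift_word_comp:
  assumes "f \<in> S \<rightarrow> carrier G" "fst ` set w \<subseteq> S"
  shows "h (lift_word G f w) = lift_word H (h \<circ> f) w"
  using assms
proof (induction w)
  case (Cons l w)
  then have "f (fst l) \<in> carrier G" "lift_word G f w \<in> carrier G"
    by (auto intro: G.lift_word_closed[of f S])
  with Cons show ?case
    by (simp add: letter_value_def comp_def)
qed simp

lemma free_basis_iso:
  assumes "group G" "group H" "h \<in> iso G H" "free_basis G B"
  shows "free_basis H (h ` B)"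
proof -
  interpret group_hom G H h
    using assms by (auto simp: group_hom_def group_hom_axioms_def iso_def)
  have B: "B \<subseteq> carrier G" "generate G B = carrier G" using assms by (auto simp: free_basis_def)
  have inj: "inj_on h (carrier G)" and surj: "h ` carrier G = carrier H"
    using assms by (auto simp: iso_def bij_betw_def)
  show ?thesis
  proof (rule H.free_basis_image)
    show "generate H (h ` B) = carrier H" using generate_img[OF B(1)] B surj by simp
    fix w assume w: "reduced_word w" "w \<noteq> []" "fst ` set w \<subseteq> B"
    have B': "(\<lambda>x. x) \<in> B \<rightarrow> carrier G" using B by auto
    have "eval_word G w \<noteq> \<one>\<^bsub>G\<^esub>" "eval_word G w \<in> carrier G"
      using w assms(4) G.lift_word_closed[OF B' w(3)] by (auto simp: free_basis_def lift_word_id)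
    then have "h (eval_word G w) \<noteq> \<one>\<^bsub>H\<^esub>"
      using inj by (metis G.one_closed hom_one inj_onD)
    then show "lift_word H h w \<noteq> \<one>\<^bsub>H\<^esub>"
      using lift_word_comp[OF B' w(3)] by (simp add: lift_word_id comp_def)
  qed (use B in auto)
qed

lemma is_free_group_iso:
  assumes "group G" "group H" "h \<in> iso G H" "is_free_group G"
  shows "is_free_group H"
  using assms free_basis_iso[OF assms(1-3)] by (auto simp: is_free_group_def)

text \<open>Freeness in the sense of words says that evaluation from the abstract free group on
  \<open>B\<close> is an isomorphism. Its inverse rewrites an element as a word, which is then read
  in \<open>H\<close>.\<close>

lemma (in group) free_basis_extend:
  assumes "free_basis G B" "group H" "f \<in> B \<rightarrow> carrier H"
  shows "\<exists>h\<in>hom G H. \<forall>b\<in>B. h b = f b"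
proof -
  interpret H: group H by fact
  let ?F = "free_group_on B"
  have B: "B \<subseteq> carrier G" "generate G B = carrier G" using assms by (auto simp: free_basis_def)
  then have B': "(\<lambda>x. x) \<in> B \<rightarrow> carrier G" by auto
  have ev_hom: "eval_word G \<in> hom ?F G"
    using lift_word_hom[OF B'] by (simp add: lift_word_id[abs_def])
  interpret ev: group_hom ?F G "eval_word G"
    by (simp add: group_hom_def group_hom_axioms_def group_free_group_on ev_hom)
  have "inj_on (eval_word G) (carrier ?F)"
    using assms(1) by (intro ev.inj_on_one_iff[THEN iffD2])
      (auto simp: free_basis_def carrier_free_group_on one_free_group_on)
  moreover have "eval_word G ` carrier ?F = carrier G"
    using lift_word_image[OF B'] B by (simp add: lift_word_id[abs_def])
  ultimately have iso: "eval_word G \<in> iso ?F G"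
    using ev_hom by (simp add: iso_def bij_betw_def)
  define j where "j = inv_into (carrier ?F) (eval_word G)"
  have "j \<in> hom G ?F"
    using group.iso_set_sym[OF group_free_group_on iso] by (simp add: j_def iso_def)
  then have "lift_word H f \<circ> j \<in> hom G H"
    using H.lift_word_hom[OF assms(3)] using Group.hom_compose by blast
  moreover have "(lift_word H f \<circ> j) b = f b" if "b \<in> B" for b
  proof -
    have "eval_word G [(b, True)] = b"
      using that B lift_word_singleton[of "\<lambda>x. x" b] by (auto simp: lift_word_id)
    then have "j b = [(b, True)]"
      unfolding j_def using \<open>inj_on (eval_word G) (carrier ?F)\<close> that
      by (metis inv_into_f_f singleton_in_free_group_on)
    then show ?thesis using that assms(3) H.lift_word_singleton[of f b] by auto
  qed
  ultimately show ?thesis by blast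
qed

lemma (in group_hom) hom_generate_subset:
  assumes "B \<subseteq> carrier G" "subgroup L H" "h ` B \<subseteq> L"
  shows "h ` generate G B \<subseteq> L"
  using H.generate_subgroup_incl[OF assms(3,2)] generate_img[OF assms(1)] by simp

lemma (in group) hom_eq_on_generate:
  assumes "group H" "h \<in> hom G H" "k \<in> hom G H" "B \<subseteq> carrier G" "\<And>b. b \<in> B \<Longrightarrow> h b = k b"
    and "x \<in> generate G B"
  shows "h x = k x"
proof -
  interpret h: group_hom G H h using assms by (simp add: group_hom_def group_hom_axioms_def is_group)
  interpret k: group_hom G H k using assms by (simp add: group_hom_def group_hom_axioms_def is_group)
  have "x \<in> carrier G" using assms generate_in_carrier by blast
  show ?thesis
    using assms(6)
  proof induction
    case (inv b)
    then show ?case using assms(4,5) by (metis h.hom_inv k.hom_inv subsetD)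
  next
    case (eng a b)
    then show ?case using generate_in_carrier[OF assms(4)] by simp
  qed (use assms in auto)
qed

section \<open>Free products of free groups\<close>

lemma (in group) eval_word_subgroup:
  assumes "subgroup H G" "fst ` set w \<subseteq> H"
  shows "eval_word (G\<lparr>carrier := H\<rparr>) w = eval_word G w"
  using assms(2) by (induction w) (auto simp: eval_word_def m_inv_consistent[OF assms(1)])

lemma (in group) free_basis_subgroup:
  assumes "subgroup H G"
  shows "free_basis (G\<lparr>carrier := H\<rparr>) B \<longleftrightarrow> B \<subseteq> H \<and> generate G B = H \<and>
     (\<forall>w. reduced_word w \<and> w \<noteq> [] \<and> fst ` set w \<subseteq> B \<longrightarrow> eval_word G w \<noteq> \<one>)"
proof (cases "B \<subseteq> H")
  case True
  then show ?thesis
    using eval_word_subgroup[OF assms]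
    by (auto simp: free_basis_def generate_consistent[OF True assms] subset_trans[OF _ True])
qed (auto simp: free_basis_def)

lemma alternating_word_single: "alternating_word G H K [x] \<longleftrightarrow> x \<in> (H \<union> K) - {\<one>\<^bsub>G\<^esub>}"
  by (simp add: alternating_word_def)

lemma alternating_word_Cons:
  assumes "x \<in> (H \<union> K) - {\<one>\<^bsub>G\<^esub>}" "\<not> (x \<in> H \<and> hd ys \<in> H)" "\<not> (x \<in> K \<and> hd ys \<in> K)"
    "alternating_word G H K ys"
  shows "alternating_word G H K (x # ys)"
  using assms by (auto simp: alternating_word_def nth_Cons hd_conv_nth split: nat.split)

text \<open>A reduced word splits into maximal syllables over \<open>A\<close> or over
  \<open>B\<close>. Each syllable is reduced and nonempty, hence nontrivial in its own factor, so
  the syllable values form an alternating word.\<close>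

lemma (in group) free_basis_internal_free_product:
  assumes prod: "internal_free_product G H K"
    and A: "free_basis (G\<lparr>carrier := H\<rparr>) A" and B: "free_basis (G\<lparr>carrier := K\<rparr>) B"
  shows "free_basis G (A \<union> B)" "A \<inter> B = {}"
proof -
  have H: "subgroup H G" and K: "subgroup K G" and HK: "H \<inter> K = {\<one>}"
    and gen: "generate G (H \<union> K) = carrier G"
    using prod by (auto simp: internal_free_product_def)
  note A = A[unfolded free_basis_subgroup[OF H]] and B = B[unfolded free_basis_subgroup[OF K]]
  have carr: "H \<subseteq> carrier G" "K \<subseteq> carrier G" using H K by (auto dest: subgroup.subset)
  have one: "b \<noteq> \<one>" if "b \<in> A \<union> B" for b
  proof -
    have "b \<in> carrier G" "eval_word G [(b, True)] \<noteq> \<one>"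
      using that A B carr by auto
    then show ?thesis by (auto simp: eval_word_def)
  qed
  show disj: "A \<inter> B = {}"
    using one A B HK by blast
  \<comment> \<open>The clauses about \<open>hd\<close> record which factor the first syllable lies
    in; the induction needs this to prepend a syllable from the other factor.\<close>
  have alt: "\<exists>xs. alternating_word G H K xs \<and> foldr (\<otimes>) xs \<one> = eval_word G w \<and>
      (fst (hd w) \<in> A \<longrightarrow> hd xs \<in> H) \<and> (fst (hd w) \<in> B \<longrightarrow> hd xs \<in> K)"
    if "reduced_word w" "w \<noteq> []" "fst ` set w \<subseteq> A \<union> B" for w
    using that
  proof (induction "length w" arbitrary: w rule: less_induct)
    case less
    define C where "C = (if fst (hd w) \<in> A then A else B)"
    define L where "L = (if fst (hd w) \<in> A then H else K)"
    define u v where "u = takeWhile (\<lambda>l. fst l \<in> C) w" and "v = dropWhile (\<lambda>l. fst l \<in> C) w"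
    have w: "w = u @ v" by (simp add: u_def v_def)
    have hd_C: "fst (hd w) \<in> C"
      using less.prems by (cases w) (auto simp: C_def)
    then have "u \<noteq> []" using less.prems by (cases w) (auto simp: u_def)
    have red: "reduced_word u" "reduced_word v"
      using less.prems reduced_word_appendD[of u v] w by auto
    have u_C: "fst ` set u \<subseteq> C" by (auto simp: u_def dest: set_takeWhileD)
    have L: "C \<subseteq> L" "subgroup L G" "L = H \<or> L = K"
      using A B H K by (auto simp: C_def L_def)
    have id: "(\<lambda>x. x) \<in> A \<union> B \<rightarrow> carrier G" "(\<lambda>x. x) \<in> C \<rightarrow> L"
      using A B carr L by auto
    interpret L: group "G\<lparr>carrier := L\<rparr>" by (rule subgroup_imp_group[OF L(2)])
    have ev_u: "eval_word G u \<noteq> \<one>"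
      using A B red u_C \<open>u \<noteq> []\<close> by (auto simp: C_def split: if_splits)
    have "eval_word (G\<lparr>carrier := L\<rparr>) u \<in> L"
      using L.lift_word_closed[of "\<lambda>x. x" C u] id(2) u_C by (simp add: lift_word_id)
    then have u_L: "eval_word G u \<in> L"
      using eval_word_subgroup[OF L(2)] u_C L(1) by auto
    have ev_w: "eval_word G w = eval_word G u \<otimes> eval_word G v"
      using lift_word_append[OF id(1), of u v] less.prems w by (auto simp: lift_word_id)
    have hd_L: "(fst (hd w) \<in> A \<longrightarrow> x \<in> H) \<and> (fst (hd w) \<in> B \<longrightarrow> x \<in> K)" if "x \<in> L" for x
      using that disj by (auto simp: L_def split: if_splits)
    show ?case
    proof (cases "v = []")
      case True
      then show ?thesis
        using ev_u u_L L(3) hd_L ev_w subgroup.mem_carrier[OF L(2) u_L]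
        by (intro exI[of _ "[eval_word G u]"]) (auto simp: alternating_word_single eval_word_def)
    next
      case False
      have "length v < length w" using w \<open>u \<noteq> []\<close> by simp
      then obtain ys where ys: "alternating_word G H K ys" "foldr (\<otimes>) ys \<one> = eval_word G v"
        "fst (hd v) \<in> A \<Longrightarrow> hd ys \<in> H" "fst (hd v) \<in> B \<Longrightarrow> hd ys \<in> K"
        using less.hyps[of v] red(2) False less.prems(3) w by auto
      have "hd ys \<noteq> \<one>" using ys(1) by (cases ys) (auto simp: alternating_word_def)
      have "fst (hd v) \<notin> C" using hd_dropWhile[of "\<lambda>l. fst l \<in> C" w] False by (simp add: v_def)
      moreover have "fst (hd v) \<in> A \<union> B" using False less.prems(3) w by (cases v) auto
      ultimately have "hd ys \<in> H \<and> L = K \<or> hd ys \<in> K \<and> L = H"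
        using ys(3,4) by (auto simp: C_def L_def split: if_splits)
      then have "alternating_word G H K (eval_word G u # ys)"
        using HK \<open>hd ys \<noteq> \<one>\<close> ev_u u_L L(3) ys(1) by (intro alternating_word_Cons) auto
      then show ?thesis
        using ys(2) ev_w hd_L[OF u_L] by (intro exI[of _ "eval_word G u # ys"]) auto
    qed
  qed
  have sub: "A \<union> B \<subseteq> carrier G" using A B carr by auto
  have "H \<union> K \<subseteq> generate G (A \<union> B)"
    using A B mono_generate[of A "A \<union> B"] mono_generate[of B "A \<union> B"] by auto
  then have "carrier G \<subseteq> generate G (A \<union> B)"
    using generate_subgroup_incl[OF _ generate_is_subgroup[OF sub], of "H \<union> K"] gen by simp
  moreover have "eval_word G w \<noteq> \<one>" if "reduced_word w" "w \<noteq> []" "fst ` set w \<subseteq> A \<union> B" for w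
    using alt[OF that] prod by (auto simp: internal_free_product_def)
  ultimately show "free_basis G (A \<union> B)"
    using generate_incl[OF sub] sub by (auto simp: free_basis_def)
qed

section \<open>Rooted trees and group actions\<close>

text \<open>A recursion that consults only the value at the parent is admissible once parents are
  smaller. It produces the Schreier transversal as well as the maps on the vertex groups of the
  cover.\<close>

lemma tree_recursion:
  assumes "wf R" "\<And>v. v \<in> V \<Longrightarrow> (p v, v) \<in> R"
  shows "\<exists>f. \<forall>v. f v = (if v \<in> V then F v (f (p v)) else a v)"
proof -
  define \<Phi> where "\<Phi> = (\<lambda>f v. if v \<in> V then F v (f (p v)) else a v)"
  have "adm_wf R \<Phi>"
    using assms(2) by (auto simp: adm_wf_def \<Phi>_def)
  then have "wfrec R \<Phi> = \<Phi> (wfrec R \<Phi>)"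
    by (rule wfrec_fixpoint[OF assms(1)])
  then show ?thesis by (metis \<Phi>_def)
qed

text \<open>With \<open>d\<close> the distance from \<open>r\<close>, the last but one vertex on a
  shortest path to \<open>v\<close> serves as its parent.\<close>

lemma breadth_first_parent:
  assumes "\<And>v. v \<in> V \<Longrightarrow> (r, v) \<in> R\<^sup>*"
  shows "\<exists>(d :: 'v \<Rightarrow> nat) p. \<forall>v\<in>V - {r}. (p v, v) \<in> R \<and> d (p v) < d v"
proof -
  define d where "d v = (LEAST n. (r, v) \<in> R ^^ n)" for v
  have "\<exists>u. (u, v) \<in> R \<and> d u < d v" if v: "v \<in> V - {r}" for v
  proof -
    obtain n where "(r, v) \<in> R ^^ n" using assms v rtrancl_power by blast
    then have dv: "(r, v) \<in> R ^^ d v" unfolding d_def by (rule LeastI)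
    then obtain m where m: "d v = Suc m" using v by (cases "d v") auto
    then obtain u where "(r, u) \<in> R ^^ m" "(u, v) \<in> R" using dv by auto
    moreover from this have "d u \<le> m" unfolding d_def by (intro Least_le)
    ultimately show ?thesis using m by auto
  qed
  then show ?thesis by metis
qed

section \<open>Actions by bijections and a criterion for freeness\<close>

lemma restrict_in_Bij:
  assumes "f \<in> S \<rightarrow> S" "g \<in> S \<rightarrow> S" "\<And>x. x \<in> S \<Longrightarrow> g (f x) = x" "\<And>x. x \<in> S \<Longrightarrow> f (g x) = x"
  shows "restrict f S \<in> carrier (BijGroup S)"
proof -
  have "bij_betw f S S" using assms by (intro bij_betwI[of _ _ _ g]) auto
  then show ?thesis by (simp add: BijGroup_def Bij_def bij_betw_restrict_eq)
qed

lemma mult_BijGroup_apply: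
  assumes "f \<in> carrier (BijGroup S)" "g \<in> carrier (BijGroup S)" "x \<in> S"
  shows "(f \<otimes>\<^bsub>BijGroup S\<^esub> g) x = f (g x)"
  using assms by (simp add: BijGroup_def compose_eq)

lemma one_BijGroup_apply: "x \<in> S \<Longrightarrow> \<one>\<^bsub>BijGroup S\<^esub> x = x"
  by (simp add: BijGroup_def)

lemma BijGroup_closed: "f \<in> carrier (BijGroup S) \<Longrightarrow> x \<in> S \<Longrightarrow> f x \<in> S"
  using Bij_imp_funcset by (auto simp: BijGroup_def)

lemma BijGroup_eqI:
  assumes "f \<in> carrier (BijGroup S)" "g \<in> carrier (BijGroup S)" "\<And>x. x \<in> S \<Longrightarrow> f x = g x"
  shows "f = g"
  using assms by (intro extensionalityI[of f S g]) (auto simp: BijGroup_def Bij_def)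

lemma (in group) action_hom:
  assumes "\<rho> \<in> hom G (BijGroup S)" "x \<in> S" "g \<in> carrier G"
  shows "\<rho> g x \<in> S" "h \<in> carrier G \<Longrightarrow> \<rho> (g \<otimes> h) x = \<rho> g (\<rho> h x)" "\<rho> \<one> x = x"
    "\<rho> (inv g) (\<rho> g x) = x" "\<rho> g (\<rho> (inv g) x) = x"
proof -
  interpret \<rho>: group_hom G "BijGroup S" \<rho>
    using assms by (simp add: group_hom_def group_hom_axioms_def is_group group_BijGroup)
  show "\<rho> g x \<in> S" using assms by (auto intro: BijGroup_closed)
  have mult: "\<rho> (a \<otimes> b) x = \<rho> a (\<rho> b x)" if "a \<in> carrier G" "b \<in> carrier G" for a b
    using that assms by (simp add: mult_BijGroup_apply del: \<rho>.hom_mult add: \<rho>.hom_mult)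
  then show "h \<in> carrier G \<Longrightarrow> \<rho> (g \<otimes> h) x = \<rho> g (\<rho> h x)" using assms by simp
  show one: "\<rho> \<one> x = x" using assms by (simp add: one_BijGroup_apply)
  show "\<rho> (inv g) (\<rho> g x) = x" "\<rho> g (\<rho> (inv g) x) = x"
    using mult[of "inv g" g] mult[of g "inv g"] one assms by simp_all
qed

text \<open>The orbit of \<open>(k, [])\<close> reads a word back: \<open>w\<close> moves this point
  to \<open>(k, reduce_word w)\<close>. A nonempty reduced word therefore moves it and cannot be
  trivial.\<close>

lemma (in group) lift_word_nontrivial:
  assumes \<sigma>: "\<sigma> \<in> Y \<rightarrow> carrier G" and \<rho>: "\<rho> \<in> hom G (BijGroup Z)"
    and Z: "\<And>x. x \<in> carrier (free_group_on Y) \<Longrightarrow> (k, x) \<in> Z"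
    and act_\<sigma>: "\<And>e x. \<lbrakk>e \<in> Y; x \<in> carrier (free_group_on Y)\<rbrakk> \<Longrightarrow>
      \<rho> (\<sigma> e) (k, x) = (k, [(e, True)] \<otimes>\<^bsub>free_group_on Y\<^esub> x)"
    and w: "reduced_word w" "w \<noteq> []" "fst ` set w \<subseteq> Y"
  shows "lift_word G \<sigma> w \<noteq> \<one>"
proof -
  let ?FY = "free_group_on Y"
  interpret F: group ?FY by (rule group_free_group_on)
  note act = action_hom[OF \<rho>]
  have nil: "(k, []) \<in> Z" by (rule Z) (simp add: carrier_free_group_on)
  have "\<rho> (lift_word G \<sigma> w) (k, []) = (k, reduce_word w)" if "fst ` set w \<subseteq> Y" for w
    using that
  proof (induction w)
    case Nil
    then show ?case using act(3)[OF nil one_closed] by (simp add: reduce_word_def)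
  next
    case (Cons l w)
    obtain e b where l: "l = (e, b)" by (cases l)
    have e: "e \<in> Y" "\<sigma> e \<in> carrier G" using Cons.prems l \<sigma> by auto
    have w: "reduce_word w \<in> carrier ?FY" using Cons.prems by (intro reduce_word_in_free_group_on) auto
    have lw: "reduce_word (l # w) = [l] \<otimes>\<^bsub>?FY\<^esub> reduce_word w"
      using reduce_word_append_right[of "[l]" w] by (simp add: mult_free_group_on)
    have "\<rho> (letter_value G \<sigma> l) (k, reduce_word w) = (k, reduce_word (l # w))"
    proof (cases b)
      case True
      then show ?thesis using act_\<sigma>[OF e(1) w] lw by (simp add: l letter_value_def)
    next
      case False
      \<comment> \<open>The hypothesis speaks of positive letters only. As \<open>\<sigma> e\<close>
        sends the point over \<open>?x\<close> to the point over \<open>reduce_word w\<close>, its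
        inverse goes the other way.\<close>
      let ?x = "[l] \<otimes>\<^bsub>?FY\<^esub> reduce_word w"
      have l_in: "[l] \<in> carrier ?FY" "[(e, True)] \<in> carrier ?FY" using e l by auto
      have "[(e, True)] \<otimes>\<^bsub>?FY\<^esub> [l] = \<one>\<^bsub>?FY\<^esub>"
        using F.r_inv[OF l_in(2)] e(1) False l by (simp add: inv_singleton_free_group_on)
      then have "[(e, True)] \<otimes>\<^bsub>?FY\<^esub> ?x = reduce_word w"
        using l_in w by (simp flip: F.m_assoc)
      then have "\<rho> (\<sigma> e) (k, ?x) = (k, reduce_word w)"
        using act_\<sigma>[OF e(1), of ?x] l_in w by simp
      then show ?thesis
        using act(4)[OF Z e(2), of ?x] l_in w False lw by (simp add: l letter_value_def)
    qed
    then show ?case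
      using Cons act(2)[OF nil, of "letter_value G \<sigma> l" "lift_word G \<sigma> w"]
        lift_word_closed[OF \<sigma>, of w] letter_value_closed[OF \<sigma>, of l] by auto
  qed
  from this[OF w(3)] show ?thesis
    using act(3)[OF nil one_closed] w by (auto simp: reduce_word_reduced)
qed

section \<open>The Nielsen--Schreier theorem\<close>

text \<open>As \<open>G\<close> is free on \<open>S\<close>, bijections prescribed for the elements
  of \<open>S\<close> alone extend to an action of \<open>G\<close>. Each of them moves the coset
  and multiplies the second coordinate by the label \<open>y\<close> of the edge crossed, which is
  trivial unless the edge lies in \<open>Y\<close>.\<close>

theorem (in group) nielsen_schreier:
  assumes S: "free_basis G S" and K: "subgroup K G"
  shows "is_free_group (G\<lparr>carrier := K\<rparr>)"
proof -
  have S_sub: "S \<subseteq> carrier G" and S_gen: "generate G S = carrier G"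
    using S by (auto simp: free_basis_def)
  have K_sub: "K \<subseteq> carrier G" using K by (rule subgroup.subset)
  define C where "C = {x <# K | x. x \<in> carrier G}"
  have K_in: "K \<in> C"
    using lcos_mult_one[OF K_sub] by (auto simp: C_def intro: exI[of _ \<one>])
  have C_sub: "c \<subseteq> carrier G" if "c \<in> C" for c
    using that l_coset_subset_G[OF K_sub] by (auto simp: C_def)
  have C_closed: "g <# c \<in> C" if "g \<in> carrier G" "c \<in> C" for g c
    using that by (auto simp: C_def lcos_m_assoc[OF K_sub])
  have C_mult: "g <# (h <# c) = (g \<otimes> h) <# c" if "g \<in> carrier G" "h \<in> carrier G" "c \<in> C" for g h c
    using that C_sub by (simp add: lcos_m_assoc)
  have C_one: "\<one> <# c = c" if "c \<in> C" for c
    using that C_sub by (simp add: lcos_mult_one)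
  have C_inv: "inv g <# (g <# c) = c" "g <# (inv g <# c) = c" if "g \<in> carrier G" "c \<in> C" for g c
    using that by (simp_all add: C_mult C_one)

  define R where "R = {(c, s <# c) | c s. c \<in> C \<and> s \<in> S} \<union> {(s <# c, c) | c s. c \<in> C \<and> s \<in> S}"
  have "(c, g <# c) \<in> R\<^sup>*" if "g \<in> generate G S" "c \<in> C" for g c
    using that
  proof (induction arbitrary: c)
    case one
    then show ?case by (simp add: C_one)
  next
    case (incl s)
    then show ?case by (auto simp: R_def)
  next
    case (inv s)
    then have "(s <# (inv s <# c), inv s <# c) \<in> R"
      using S_sub C_closed by (auto simp: R_def)
    then show ?case using inv S_sub C_inv by auto
  next
    case (eng g h)
    then have "g \<in> carrier G" "h \<in> carrier G" using S_gen by auto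
    then show ?case using eng.IH[of "h <# c"] eng.IH(2)[of c] eng.prems
      by (metis C_closed C_mult eng.IH rtrancl_trans)
  qed
  then have "(K, c) \<in> R\<^sup>*" if "c \<in> C" for c
    using that K_in S_gen by (auto simp: C_def)
  then obtain d :: "'a set \<Rightarrow> nat" and p
    where p: "\<And>c. c \<in> C - {K} \<Longrightarrow> (p c, c) \<in> R \<and> d (p c) < d c"
    using breadth_first_parent[of C K R] by blast
  \<comment> \<open>The edge from \<open>p c\<close> to \<open>c\<close> may be traversed along its
    direction or against it, so its label is an element of \<open>S\<close> or the inverse of
    one.\<close>
  have "\<exists>m. m \<in> carrier G \<and> c = m <# p c \<and> p c \<in> C \<and> (m \<in> S \<or> inv m \<in> S)"
    if c: "c \<in> C - {K}" for c
  proof -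
    consider s where "s \<in> S" "p c \<in> C" "c = s <# p c" | s where "s \<in> S" "p c = s <# c"
      using p[OF c] by (auto simp: R_def)
    then show ?thesis
    proof cases
      case 1
      then show ?thesis using S_sub by auto
    next
      case (2 s)
      then show ?thesis using S_sub c C_inv C_closed by (intro exI[of _ "inv s"]) auto
    qed
  qed
  then obtain m where m: "\<And>c. c \<in> C - {K} \<Longrightarrow>
      m c \<in> carrier G \<and> c = m c <# p c \<and> p c \<in> C \<and> (m c \<in> S \<or> inv (m c) \<in> S)"
    by metis
  \<comment> \<open>The product of the labels along the tree path from \<open>K\<close> to
    \<open>c\<close>: a Schreier transversal, with the value \<open>\<one>\<close> at the base
    coset.\<close>
  have "\<exists>\<tau>. \<forall>c. \<tau> c = (if c \<in> C - {K} then m c \<otimes> \<tau> (p c) else \<one>)"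
    using p by (intro tree_recursion[of "measure d"]) auto
  then obtain \<tau> where \<tau>: "\<And>c. \<tau> c = (if c \<in> C - {K} then m c \<otimes> \<tau> (p c) else \<one>)"
    by blast
  have \<tau>_step: "\<tau> c = m c \<otimes> \<tau> (p c)" if "c \<in> C - {K}" for c
    using that by (subst \<tau>) simp
  have \<tau>_K: "\<tau> K = \<one>" by (subst \<tau>) simp
  have \<tau>_coset: "\<tau> c \<in> carrier G \<and> \<tau> c <# K = c" if "c \<in> C" for c
    using that
  proof (induction "d c" arbitrary: c rule: less_induct)
    case less
    show ?case
    proof (cases "c = K")
      case False
      then have "c \<in> C - {K}" using less.prems by simp
      then show ?thesis
        using less.hyps[of "p c"] p[of c] m[of c] \<tau>_step[of c] by (auto simp flip: C_mult[OF _ _ K_in])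
    qed (simp add: \<tau>_K C_one K_in)
  qed
  then have \<tau>_carr: "\<tau> c \<in> carrier G" if "c \<in> C" for c using that by blast

  \<comment> \<open>\<open>Y\<close> consists of the edges of the Schreier graph outside the tree traced by \<open>\<tau>\<close>.\<close>
  define Y where "Y = {(c, s). c \<in> C \<and> s \<in> S \<and> s \<otimes> \<tau> c \<noteq> \<tau> (s <# c)}"
  define \<sigma> where "\<sigma> = (\<lambda>(c, s). inv (\<tau> (s <# c)) \<otimes> s \<otimes> \<tau> c)"
  define y where "y e = (if e \<in> Y then [(e, True)] else [])" for e
  interpret F: group "free_group_on Y" by (rule group_free_group_on)
  let ?FY = "free_group_on Y"
  have y_in: "y e \<in> carrier ?FY" for e
    by (simp add: y_def carrier_free_group_on)
  define Z where "Z = C \<times> carrier ?FY"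
  define a where "a s = (\<lambda>(c, x). (s <# c, y (c, s) \<otimes>\<^bsub>?FY\<^esub> x))" for s
  define a' where "a' s = (\<lambda>(c, x). (inv s <# c, inv\<^bsub>?FY\<^esub> (y (inv s <# c, s)) \<otimes>\<^bsub>?FY\<^esub> x))" for s
  have "restrict (a s) Z \<in> carrier (BijGroup Z)" if "s \<in> S" for s
    by (rule restrict_in_Bij[of _ _ "a' s"])
      (use that S_sub C_closed C_inv y_in in \<open>auto simp: Z_def a_def a'_def simp flip: F.m_assoc\<close>)
  then obtain \<rho> where \<rho>: "\<rho> \<in> hom G (BijGroup Z)" and \<rho>_S: "\<And>s. s \<in> S \<Longrightarrow> \<rho> s = restrict (a s) Z"
    using free_basis_extend[OF S group_BijGroup, of "\<lambda>s. restrict (a s) Z"] by blast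
  note act = action_hom[OF \<rho>]
  note act_one = act(3)[OF _ one_closed]
  have \<rho>_s: "\<rho> s (c, x) = (s <# c, y (c, s) \<otimes>\<^bsub>?FY\<^esub> x)"
    if "s \<in> S" "c \<in> C" "x \<in> carrier ?FY" for s c x
    using that by (simp add: \<rho>_S a_def Z_def)
  have \<rho>_tree: "\<rho> s (c, x) = (s <# c, x)"
    if "s \<in> S" "c \<in> C" "x \<in> carrier ?FY" "s \<otimes> \<tau> c = \<tau> (s <# c)" for s c x
  proof -
    have "y (c, s) = \<one>\<^bsub>?FY\<^esub>" using that by (simp add: y_def Y_def one_free_group_on)
    then show ?thesis using that by (simp add: \<rho>_s)
  qed
  \<comment> \<open>Tree paths cross only edges with trivial label, so the second coordinate is
    carried along unchanged.\<close>
  have \<rho>_\<tau>: "\<rho> (\<tau> c) (K, x) = (c, x)" if "c \<in> C" "x \<in> carrier ?FY" for c x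
    using that
  proof (induction "d c" arbitrary: c rule: less_induct)
    case less
    show ?case
    proof (cases "c = K")
      case True
      then show ?thesis using less.prems act_one[of "(K, x)"] K_in by (simp add: \<tau>_K Z_def)
    next
      case False
      then have c: "c \<in> C - {K}" using less.prems by simp
      have Kx: "(K, x) \<in> Z" "(c, x) \<in> Z" using less.prems K_in by (auto simp: Z_def)
      have IH: "\<rho> (\<tau> (p c)) (K, x) = (p c, x)" using less p[OF c] m[OF c] by auto
      have pc: "p c \<in> C" "\<tau> (p c) \<in> carrier G" using m[OF c] \<tau>_carr by auto
      have "\<rho> (m c) (p c, x) = (c, x)"
      proof (cases "m c \<in> S")
        case True
        then show ?thesis
          using \<rho>_tree[of "m c" "p c" x] m[OF c] \<tau>_step[OF c] less.prems by auto
      next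
        case False
        let ?s = "inv (m c)"
        have s: "?s \<in> S" "?s <# c = p c" "m c \<in> carrier G" using False m[OF c] C_inv by (metis)+
        \<comment> \<open>The edge is labelled in the direction from \<open>c\<close> back to
          \<open>p c\<close>; the recursion for \<open>\<tau>\<close> shows that it still lies
          outside \<open>Y\<close>, so its action can be computed and then inverted.\<close>
        have "?s \<otimes> \<tau> c = \<tau> (?s <# c)"
          using \<tau>_step[OF c] s pc by (simp flip: m_assoc)
        then have "\<rho> ?s (c, x) = (p c, x)"
          using \<rho>_tree[of ?s c x] s less.prems by auto
        then show ?thesis using act(5)[of "(c, x)" "m c"] Kx s by simp
      qed
      then show ?thesis
        using act(2)[of "(K, x)" "m c" "\<tau> (p c)"] Kx m[OF c] pc IH \<tau>_step[OF c] by simp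
    qed
  qed

  have \<sigma>_carr: "\<sigma> (c, s) \<in> carrier G" if "c \<in> C" "s \<in> S" for c s
    using that S_sub \<tau>_carr C_closed by (auto simp: \<sigma>_def)
  \<comment> \<open>\<open>\<sigma> e\<close> is a loop at the base coset: out along the tree, once
    across \<open>e\<close>, and back along the tree. Only the crossing of \<open>e\<close>
    contributes a letter.\<close>
  have \<rho>_\<sigma>: "\<rho> (\<sigma> e) (K, x) = (K, [(e, True)] \<otimes>\<^bsub>?FY\<^esub> x)" if "e \<in> Y" "x \<in> carrier ?FY" for e x
  proof -
    obtain c s where e: "e = (c, s)" "c \<in> C" "s \<in> S" using \<open>e \<in> Y\<close> by (auto simp: Y_def)
    let ?sc = "s <# c" and ?x = "[(e, True)] \<otimes>\<^bsub>?FY\<^esub> x"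
    have s: "s \<in> carrier G" "?sc \<in> C" using e S_sub C_closed by auto
    have x: "?x \<in> carrier ?FY" "(K, x) \<in> Z" "(K, ?x) \<in> Z"
      using that K_in by (auto simp: Z_def)
    have "\<rho> (\<sigma> e) (K, x) = \<rho> (inv (\<tau> ?sc)) (\<rho> s (\<rho> (\<tau> c) (K, x)))"
      using x e s \<tau>_carr act by (simp add: \<sigma>_def m_assoc)
    also have "\<dots> = \<rho> (inv (\<tau> ?sc)) (?sc, ?x)"
      using e that by (simp add: \<rho>_\<tau> \<rho>_s y_def)
    also have "\<dots> = \<rho> (inv (\<tau> ?sc)) (\<rho> (\<tau> ?sc) (K, ?x))"
      using x s by (simp add: \<rho>_\<tau>)
    also have "\<dots> = (K, ?x)"
      using act(4) x s \<tau>_carr by simp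
    finally show ?thesis .
  qed
  have \<sigma>_Y: "\<sigma> \<in> Y \<rightarrow> carrier G" using \<sigma>_carr by (auto simp: Y_def)
  have \<sigma>_free: "lift_word G \<sigma> w \<noteq> \<one>" if "reduced_word w" "w \<noteq> []" "fst ` set w \<subseteq> Y" for w
    by (rule lift_word_nontrivial[OF \<sigma>_Y \<rho> _ \<rho>_\<sigma> that]) (use K_in in \<open>simp add: Z_def\<close>)

  have \<sigma>_K: "\<sigma> ` Y \<subseteq> K"
  proof safe
    fix c s assume "(c, s) \<in> Y"
    then have cs: "c \<in> C" "s \<in> carrier G" "s \<in> S" using S_sub by (auto simp: Y_def)
    let ?sc = "s <# c"
    have sc: "?sc \<in> C" using cs C_closed by auto
    have "\<sigma> (c, s) <# K = inv (\<tau> ?sc) <# (s <# (\<tau> c <# K))"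
      using cs sc \<tau>_carr by (simp add: \<sigma>_def C_mult K_in m_assoc C_closed)
    also have "\<dots> = inv (\<tau> ?sc) <# (\<tau> ?sc <# K)" using \<tau>_coset cs sc by simp
    also have "\<dots> = K" using C_inv K_in sc \<tau>_carr by simp
    finally have "\<sigma> (c, s) <# K = K" .
    moreover have "\<sigma> (c, s) \<in> \<sigma> (c, s) <# K"
      using subgroup.one_closed[OF K] \<sigma>_carr[OF cs(1,3)] by (force simp: l_coset_def)
    ultimately show "\<sigma> (c, s) \<in> K" by simp
  qed
  let ?gen = "generate G (\<sigma> ` Y)"
  have gen_sub: "subgroup ?gen G" using \<sigma>_Y by (intro generate_is_subgroup) auto
  \<comment> \<open>Reidemeister-Schreier rewriting. The claim ranges over all cosets so that
    products telescope, the middle factors \<open>\<tau> (h <# c)\<close> cancelling. For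
    \<open>g \<in> K\<close> and \<open>c = K\<close> the expression is \<open>g\<close>
    itself.\<close>
  have gen: "inv (\<tau> (g <# c)) \<otimes> g \<otimes> \<tau> c \<in> ?gen" if "g \<in> generate G S" "c \<in> C" for g c
    using that
  proof (induction arbitrary: c)
    case one
    then show ?case using \<tau>_carr by (simp add: C_one generate.one)
  next
    case (incl s)
    then have s: "s \<in> carrier G" "s <# c \<in> C" using S_sub C_closed by auto
    show ?case
    proof (cases "(c, s) \<in> Y")
      case True
      then show ?thesis by (intro generate.incl) (auto simp: \<sigma>_def intro!: image_eqI[of _ _ "(c, s)"])
    next
      case False
      then have "s \<otimes> \<tau> c = \<tau> (s <# c)" using incl by (auto simp: Y_def)
      then show ?thesis
        using s incl \<tau>_carr by (simp add: m_assoc generate.one)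
    qed
  next
    case (inv s)
    let ?c = "inv s <# c"
    have s: "s \<in> carrier G" "?c \<in> C" "s <# ?c = c" using inv S_sub C_closed C_inv by auto
    have "inv (\<tau> c) \<otimes> s \<otimes> \<tau> ?c \<in> ?gen"
    proof (cases "(?c, s) \<in> Y")
      case True
      then show ?thesis
        using s by (intro generate.incl) (auto simp: \<sigma>_def intro!: image_eqI[of _ _ "(?c, s)"])
    next
      case False
      then have "s \<otimes> \<tau> ?c = \<tau> c" using inv s by (auto simp: Y_def)
      then show ?thesis
        using s inv \<tau>_carr by (simp add: m_assoc generate.one)
    qed
    then have "inv (inv (\<tau> c) \<otimes> s \<otimes> \<tau> ?c) \<in> ?gen"
      using subgroup.m_inv_closed[OF gen_sub] by simp
    then show ?case
      using s inv \<tau>_carr by (simp add: inv_mult_group m_assoc)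
  next
    case (eng g h)
    then have gh: "g \<in> carrier G" "h \<in> carrier G" using S_gen by auto
    have hc: "h <# c \<in> C" "g <# (h <# c) \<in> C" using gh eng.prems C_closed by auto
    let ?t = "\<tau> (h <# c)"
    have "(inv (\<tau> (g <# (h <# c))) \<otimes> g \<otimes> ?t) \<otimes> (inv ?t \<otimes> h \<otimes> \<tau> c)
        = inv (\<tau> (g <# (h <# c))) \<otimes> (g \<otimes> h) \<otimes> \<tau> c"
    proof -
      have "?t \<otimes> (inv ?t \<otimes> x) = x" if "x \<in> carrier G" for x
        using that \<tau>_carr[OF hc(1)] by (simp flip: m_assoc)
      then show ?thesis
        using gh hc \<tau>_carr eng.prems by (simp add: m_assoc)
    qed
    then show ?case
      using generate.eng[OF eng.IH(1)[OF hc(1)] eng.IH(2)[OF eng.prems]] gh eng.prems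
      by (simp add: C_mult)
  qed
  have "K \<subseteq> ?gen"
  proof
    fix k assume "k \<in> K"
    then have k: "k \<in> carrier G" "k <# K = K" using K_sub K
      by (auto simp: coset_join3 subgroup.mem_carrier)
    then show "k \<in> ?gen" using gen[of k K] S_gen K_in by (simp add: \<tau>_K)
  qed
  moreover have "?gen \<subseteq> K" by (rule generate_subgroup_incl[OF \<sigma>_K K])
  ultimately have gen_K: "?gen = K" by simp
  interpret GK: group "G\<lparr>carrier := K\<rparr>" by (rule subgroup_imp_group[OF K])
  have "free_basis (G\<lparr>carrier := K\<rparr>) (\<sigma> ` Y)"
  proof (rule GK.free_basis_image)
    show "generate (G\<lparr>carrier := K\<rparr>) (\<sigma> ` Y) = carrier (G\<lparr>carrier := K\<rparr>)"
      using gen_K by (simp add: generate_consistent[OF \<sigma>_K K])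
    fix w assume w: "reduced_word w" "w \<noteq> []" "fst ` set w \<subseteq> Y"
    have "lift_word (G\<lparr>carrier := K\<rparr>) \<sigma> w = lift_word G \<sigma> w"
      unfolding lift_word_def using \<sigma>_K w by (intro eval_word_subgroup[OF K]) (fastforce simp: image_subset_iff)
    moreover have "lift_word G \<sigma> w \<noteq> \<one>" by (rule \<sigma>_free[OF w])
    ultimately show "lift_word (G\<lparr>carrier := K\<rparr>) \<sigma> w \<noteq> \<one>\<^bsub>G\<lparr>carrier := K\<rparr>\<^esub>" by simp
  qed (use \<sigma>_K in auto)
  then show ?thesis by (auto simp: is_free_group_def GK.is_group)
qed

section \<open>Spanning trees\<close>

text \<open>The last clause, that each tree edge is the parent edge of one of its ends, is where the
  edge count of a tree enters: sending a vertex to its parent edge is injective on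
  \<open>V - {r}\<close>, and \<open>T\<close> has exactly as many elements.\<close>

lemma spanning_tree_parents:
  fixes V :: "'v set" and o' t :: "'e \<Rightarrow> 'v"
  defines "src \<equiv> \<lambda>l. if snd l then o' (fst l) else t (fst l)"
    and "tgt \<equiv> \<lambda>l. if snd l then t (fst l) else o' (fst l)"
  assumes tree: "spanning_tree V E o' t T" and fin: "finite V" and finE: "finite E"
    and ends: "o' ` E \<subseteq> V" "t ` E \<subseteq> V" and r: "r \<in> V"
  shows "\<exists>(d :: 'v \<Rightarrow> nat) f.
    (\<forall>v\<in>V - {r}. fst (f v) \<in> T \<and> tgt (f v) = v \<and> src (f v) \<in> V \<and> d (src (f v)) < d v) \<and>
    (\<forall>e\<in>T. \<exists>b. tgt (e, b) \<in> V - {r} \<and> f (tgt (e, b)) = (e, b))"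
proof -
  have TE: "T \<subseteq> E" and card: "card T + 1 = card V" and conn: "graph_connected V T o' t"
    using tree by (auto simp: spanning_tree_def)
  define R where "R = {(o' e, t e) | e. e \<in> T} \<union> {(t e, o' e) | e. e \<in> T}"
  have "(r, v) \<in> R\<^sup>*" if "v \<in> V" for v
    using conn r that by (auto simp: graph_connected_def R_def)
  then obtain d :: "'v \<Rightarrow> nat" and p where p: "\<And>v. v \<in> V - {r} \<Longrightarrow> (p v, v) \<in> R \<and> d (p v) < d v"
    using breadth_first_parent[of V r R] by blast
  have "\<exists>l. fst l \<in> T \<and> tgt l = v \<and> src l = p v" if v: "v \<in> V - {r}" for v
  proof -
    consider e where "e \<in> T" "p v = o' e" "v = t e" | e where "e \<in> T" "p v = t e" "v = o' e"
      using p[OF v] by (auto simp: R_def)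
    then show ?thesis
    proof cases
      case (1 e)
      then show ?thesis by (intro exI[of _ "(e, True)"]) (simp add: src_def tgt_def)
    next
      case (2 e)
      then show ?thesis by (intro exI[of _ "(e, False)"]) (simp add: src_def tgt_def)
    qed
  qed
  then obtain f where f: "\<And>v. v \<in> V - {r} \<Longrightarrow> fst (f v) \<in> T \<and> tgt (f v) = v \<and> src (f v) = p v"
    by metis
  have src_V: "src l \<in> V" if "fst l \<in> T" for l
    using that TE ends by (auto simp: src_def)
  have less: "d (src (f v)) < d v" if "v \<in> V - {r}" for v using p f that by simp
  \<comment> \<open>A shared parent edge traversed in the same direction ends at the same vertex;
    traversed in opposite directions it would put each of \<open>v\<close> and \<open>w\<close>
    strictly closer to the root than the other.\<close>
  have "inj_on (fst \<circ> f) (V - {r})"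
  proof (rule inj_onI, rule ccontr)
    fix v w assume v: "v \<in> V - {r}" and w: "w \<in> V - {r}" and eq: "(fst \<circ> f) v = (fst \<circ> f) w" "v \<noteq> w"
    have "snd (f v) \<noteq> snd (f w)"
    proof
      assume "snd (f v) = snd (f w)"
      then have "f v = f w" using eq by (simp add: prod_eq_iff)
      then have "tgt (f v) = tgt (f w)" by simp
      then show False using f[OF v] f[OF w] eq(2) by simp
    qed
    then have "src (f v) = tgt (f w)" "src (f w) = tgt (f v)" using eq by (auto simp: src_def tgt_def)
    then show False using less[OF v] less[OF w] f[OF v] f[OF w] by simp
  qed
  then have "card ((fst \<circ> f) ` (V - {r})) = card T"
    using card fin r card_image by fastforce
  moreover have "(fst \<circ> f) ` (V - {r}) \<subseteq> T" using f by auto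
  moreover have "finite T" using finE TE by (rule finite_subset[rotated])
  ultimately have surj: "(fst \<circ> f) ` (V - {r}) = T" by (intro card_subset_eq)
  have "\<exists>b. tgt (e, b) \<in> V - {r} \<and> f (tgt (e, b)) = (e, b)" if "e \<in> T" for e
  proof -
    obtain v where v: "v \<in> V - {r}" "fst (f v) = e" using surj \<open>e \<in> T\<close> by force
    then show ?thesis using f[OF v(1)] by (intro exI[of _ "snd (f v)"]) (metis prod.collapse)
  qed
  then show ?thesis using f src_V less by blast
qed

section \<open>Presentation of the fundamental group\<close>

lemma (in group) normal_normal_closure:
  assumes "R \<subseteq> carrier G"
  shows "normal_closure G R \<lhd> G"
  unfolding normal_closure_def
proof (rule normal_generateI)
  fix h x assume "h \<in> {g \<otimes> r \<otimes> inv g |g r. g \<in> carrier G \<and> r \<in> R}" and x: "x \<in> carrier G"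
  then obtain g r where g: "g \<in> carrier G" "r \<in> R" "h = g \<otimes> r \<otimes> inv g" by blast
  moreover from this have "r \<in> carrier G" using assms by blast
  ultimately have "x \<otimes> h \<otimes> inv x = (x \<otimes> g) \<otimes> r \<otimes> inv (x \<otimes> g)"
    using x by (simp add: m_assoc inv_mult_group)
  then show "x \<otimes> h \<otimes> inv x \<in> {g \<otimes> r \<otimes> inv g |g r. g \<in> carrier G \<and> r \<in> R}"
    using g x by blast
qed (use assms in auto)

lemma (in group) normal_closure_incl:
  assumes "R \<subseteq> carrier G" "r \<in> R"
  shows "r \<in> normal_closure G R"
proof -
  have "r = \<one> \<otimes> r \<otimes> inv \<one>" using assms by auto
  then show ?thesis
    unfolding normal_closure_def using assms(2) by (intro generate.incl) blast
qed

lemma (in group) normal_closure_minimal: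
  assumes "N \<lhd> G" "R \<subseteq> N"
  shows "normal_closure G R \<subseteq> N"
  unfolding normal_closure_def using assms normal.inv_op_closed2[OF assms(1)]
  by (intro generate_subgroup_incl normal_imp_subgroup) auto

lemma (in group) eq_if_mult_inv_one:
  assumes "x \<in> carrier G" "y \<in> carrier G" "x \<otimes> inv y = \<one>"
  shows "x = y"
  using assms by (simp add: inv_solve_right')

locale clean_graph_of_groups =
  fixes V :: "'v set" and E :: "'e set" and o' t :: "'e \<Rightarrow> 'v"
    and Gv :: "'v \<Rightarrow> 'a monoid" and Ge :: "'e \<Rightarrow> 'b monoid"
    and \<alpha> \<omega> :: "'e \<Rightarrow> 'b \<Rightarrow> 'a" and T :: "'e set"
  assumes clean: "alg_clean_graph_of_free_groups V E o' t Gv Ge \<alpha> \<omega>"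
    and tree: "spanning_tree V E o' t T"
begin

lemma fin: "finite V" "finite E"
  and ends: "o' ` E \<subseteq> V" "t ` E \<subseteq> V"
  and T_sub: "T \<subseteq> E"
  using clean tree by (simp_all add: alg_clean_graph_of_free_groups_def spanning_tree_def)

lemma vertex_group: "v \<in> V \<Longrightarrow> group (Gv v)"
  using clean by (simp add: alg_clean_graph_of_free_groups_def is_fin_rank_free_group_def)

lemma edge_group: "e \<in> E \<Longrightarrow> group (Ge e)"
  using clean by (simp add: alg_clean_graph_of_free_groups_def is_fin_rank_free_group_def)

abbreviation gens where "gens \<equiv> gog_generators V E Gv"
abbreviation rels where "rels \<equiv> gog_relators V E o' t Gv Ge \<alpha> \<omega> T"
abbreviation F where "F \<equiv> free_group_on gens"
abbreviation NC where "NC \<equiv> normal_closure F rels"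
abbreviation G where "G \<equiv> gog_fundamental_group V E o' t Gv Ge \<alpha> \<omega> T"

definition gen where "gen x = NC #>\<^bsub>F\<^esub> [(x, True)]"

sublocale F: group F by (rule group_free_group_on)

lemma Inl_gens [simp]: "Inl (v, g) \<in> gens \<longleftrightarrow> v \<in> V \<and> g \<in> carrier (Gv v)"
  and Inr_gens [simp]: "Inr e \<in> gens \<longleftrightarrow> e \<in> E"
  by (auto simp: gog_generators_def)

lemma edge_maps:
  assumes "e \<in> E"
  shows "\<alpha> e \<in> hom (Ge e) (Gv (o' e))" "\<omega> e \<in> hom (Ge e) (Gv (t e))"
    "inj_on (\<alpha> e) (carrier (Ge e))" "inj_on (\<omega> e) (carrier (Ge e))"
    "free_factor (\<alpha> e ` carrier (Ge e)) (Gv (o' e))" "free_factor (\<omega> e ` carrier (Ge e)) (Gv (t e))"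
  using clean assms unfolding alg_clean_graph_of_free_groups_def by blast+

lemma edge_maps_closed:
  assumes "e \<in> E" "a \<in> carrier (Ge e)"
  shows "\<alpha> e a \<in> carrier (Gv (o' e))" "\<omega> e a \<in> carrier (Gv (t e))"
  using edge_maps(1,2)[OF assms(1)] assms(2) by (auto intro: hom_in_carrier)

lemma ends_in [simp]: "e \<in> E \<Longrightarrow> o' e \<in> V" "e \<in> E \<Longrightarrow> t e \<in> V"
  using ends by auto

lemma vertex_mult_closed:
  "v \<in> V \<Longrightarrow> g \<in> carrier (Gv v) \<Longrightarrow> h \<in> carrier (Gv v) \<Longrightarrow> g \<otimes>\<^bsub>Gv v\<^esub> h \<in> carrier (Gv v)"
  by (rule monoid.m_closed[OF group.is_monoid[OF vertex_group]])

lemma rels_sub: "rels \<subseteq> carrier F"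
proof
  fix r assume "r \<in> rels"
  then consider v g h where "v \<in> V" "g \<in> carrier (Gv v)" "h \<in> carrier (Gv v)"
      "r = reduce_word [(Inl (v, g), True), (Inl (v, h), True), (Inl (v, g \<otimes>\<^bsub>Gv v\<^esub> h), False)]"
    | e a where "e \<in> E" "a \<in> carrier (Ge e)"
      "r = reduce_word [(Inr e, True), (Inl (t e, \<omega> e a), True), (Inr e, False), (Inl (o' e, \<alpha> e a), False)]"
    | e where "e \<in> T" "r = [(Inr e, True)]"
    unfolding gog_relators_def by blast
  then show "r \<in> carrier F"
  proof cases
    case (1 v g h)
    show ?thesis unfolding 1(4) by (intro reduce_word_in_free_group_on) (use 1 in \<open>simp add: vertex_mult_closed\<close>)
  next
    case (2 e a)
    show ?thesis unfolding 2(3) by (intro reduce_word_in_free_group_on) (use 2 in \<open>simp add: edge_maps_closed\<close>)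
  next
    case (3 e)
    then show ?thesis using T_sub by auto
  qed
qed

sublocale NC: normal NC F by (rule F.normal_normal_closure[OF rels_sub])

lemma G_def: "G = F Mod NC"
  by (simp add: gog_fundamental_group_def Let_def)

lemma group_G: "group G"
  unfolding G_def by (rule NC.factorgroup_is_group)

sublocale G: group G by (rule group_G)

sublocale quot: group_hom F G "\<lambda>w. NC #>\<^bsub>F\<^esub> w"
  using NC.r_coset_hom_Mod by unfold_locales (simp add: G_def)

lemma gen_closed: "gen \<in> gens \<rightarrow> carrier G"
  by (auto simp: gen_def intro!: quot.hom_closed)

lemma gen_closed' [simp]: "x \<in> gens \<Longrightarrow> gen x \<in> carrier G"
  using gen_closed by auto

lemma quot_reduce_word:
  assumes "fst ` set w \<subseteq> gens"
  shows "NC #>\<^bsub>F\<^esub> reduce_word w = lift_word G gen w"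
  using quot.lift_word_comp[of "\<lambda>x. [(x, True)]" gens w] assms
  by (simp add: lift_word_free_group_on comp_def gen_def[abs_def])

lemma generate_gen: "generate G (gen ` gens) = carrier G"
proof -
  have "lift_word G gen ` carrier F = (\<lambda>w. NC #>\<^bsub>F\<^esub> w) ` carrier F"
    by (intro image_cong) (auto simp: carrier_free_group_on reduce_word_reduced simp flip: quot_reduce_word)
  also have "\<dots> = carrier G" by (simp add: G_def carrier_FactGroup)
  finally show ?thesis by (simp add: G.lift_word_image[OF gen_closed])
qed

lemma relator_trivial:
  assumes "reduce_word w \<in> rels" "fst ` set w \<subseteq> gens"
  shows "lift_word G gen w = \<one>\<^bsub>G\<^esub>"
proof -
  have "NC #>\<^bsub>F\<^esub> reduce_word w = NC"
    using F.normal_closure_incl[OF rels_sub assms(1)] NC.subgroup_axioms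
    by (intro F.coset_join2) (auto dest: subgroup.mem_carrier)
  then show ?thesis using quot_reduce_word[OF assms(2)] by (simp add: G_def)
qed

lemma gen_vertex:
  assumes "v \<in> V" "g \<in> carrier (Gv v)" "h \<in> carrier (Gv v)"
  shows "gen (Inl (v, g \<otimes>\<^bsub>Gv v\<^esub> h)) = gen (Inl (v, g)) \<otimes>\<^bsub>G\<^esub> gen (Inl (v, h))"
proof -
  let ?w = "[(Inl (v, g), True), (Inl (v, h), True), (Inl (v, g \<otimes>\<^bsub>Gv v\<^esub> h), False)]"
  have "lift_word G gen ?w = \<one>\<^bsub>G\<^esub>"
    using assms by (intro relator_trivial) (auto simp: gog_relators_def vertex_mult_closed)
  then have "gen (Inl (v, g)) \<otimes>\<^bsub>G\<^esub> gen (Inl (v, h)) \<otimes>\<^bsub>G\<^esub> inv\<^bsub>G\<^esub> gen (Inl (v, g \<otimes>\<^bsub>Gv v\<^esub> h)) = \<one>\<^bsub>G\<^esub>"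
    using assms by (simp add: letter_value_def vertex_mult_closed G.m_assoc)
  then show ?thesis
    by (rule G.eq_if_mult_inv_one[symmetric, rotated 2]) (use assms in \<open>auto simp: vertex_mult_closed\<close>)
qed

lemma gen_edge:
  assumes "e \<in> E" "a \<in> carrier (Ge e)"
  shows "gen (Inr e) \<otimes>\<^bsub>G\<^esub> gen (Inl (t e, \<omega> e a)) = gen (Inl (o' e, \<alpha> e a)) \<otimes>\<^bsub>G\<^esub> gen (Inr e)"
proof -
  let ?w = "[(Inr e, True), (Inl (t e, \<omega> e a), True), (Inr e, False), (Inl (o' e, \<alpha> e a), False)]"
  have "lift_word G gen ?w = \<one>\<^bsub>G\<^esub>"
    using assms by (intro relator_trivial) (auto simp: gog_relators_def edge_maps_closed)
  then have "(gen (Inr e) \<otimes>\<^bsub>G\<^esub> gen (Inl (t e, \<omega> e a))) \<otimes>\<^bsub>G\<^esub>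
      inv\<^bsub>G\<^esub> (gen (Inl (o' e, \<alpha> e a)) \<otimes>\<^bsub>G\<^esub> gen (Inr e)) = \<one>\<^bsub>G\<^esub>"
    using assms by (simp add: letter_value_def edge_maps_closed G.m_assoc G.inv_mult_group)
  then show ?thesis
    by (rule G.eq_if_mult_inv_one[rotated 2]) (use assms in \<open>auto simp: edge_maps_closed\<close>)
qed

lemma gen_tree:
  assumes "e \<in> T"
  shows "gen (Inr e) = \<one>\<^bsub>G\<^esub>"
proof -
  have "e \<in> E" using assms T_sub by auto
  have "reduce_word [(Inr e :: ('v \<times> 'a) + 'e, True)] \<in> rels"
    using assms by (auto simp: gog_relators_def reduce_word_reduced)
  then have "lift_word G gen [(Inr e, True)] = \<one>\<^bsub>G\<^esub>"
    using \<open>e \<in> E\<close> by (intro relator_trivial) auto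
  then show ?thesis using \<open>e \<in> E\<close> by (simp add: letter_value_def)
qed

text \<open>Von Dyck's argument: the kernel of the lifted map is normal and contains the relators,
  hence their normal closure. Edge relations are phrased as equations between products, a form that
  can be checked point by point for an action.\<close>

lemma universal_property:
  assumes H: "group H" and f: "f \<in> gens \<rightarrow> carrier H"
    and vertex: "\<And>v g h. \<lbrakk>v \<in> V; g \<in> carrier (Gv v); h \<in> carrier (Gv v)\<rbrakk> \<Longrightarrow>
      f (Inl (v, g \<otimes>\<^bsub>Gv v\<^esub> h)) = f (Inl (v, g)) \<otimes>\<^bsub>H\<^esub> f (Inl (v, h))"
    and edge: "\<And>e a. \<lbrakk>e \<in> E; a \<in> carrier (Ge e)\<rbrakk> \<Longrightarrow>
      f (Inr e) \<otimes>\<^bsub>H\<^esub> f (Inl (t e, \<omega> e a)) = f (Inl (o' e, \<alpha> e a)) \<otimes>\<^bsub>H\<^esub> f (Inr e)"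
    and tree_edge: "\<And>e. e \<in> T \<Longrightarrow> f (Inr e) = \<one>\<^bsub>H\<^esub>"
  shows "\<exists>h\<in>hom G H. \<forall>x\<in>gens. h (gen x) = f x"
proof -
  interpret H: group H by fact
  interpret h: group_hom F H "lift_word H f"
    by unfold_locales (rule H.lift_word_hom[OF f])
  have f': "f x \<in> carrier H" if "x \<in> gens" for x using f that by auto
  have lift: "lift_word H f (reduce_word w) = lift_word H f w" if "fst ` set w \<subseteq> gens" for w
    by (rule H.lift_word_reduce_word[OF f that])
  have "rels \<subseteq> kernel F H (lift_word H f)"
  proof
    fix r assume r: "r \<in> rels"
    have "lift_word H f r = \<one>\<^bsub>H\<^esub>"
    proof -
      consider v g h where "v \<in> V" "g \<in> carrier (Gv v)" "h \<in> carrier (Gv v)"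
          "r = reduce_word [(Inl (v, g), True), (Inl (v, h), True), (Inl (v, g \<otimes>\<^bsub>Gv v\<^esub> h), False)]"
        | e a where "e \<in> E" "a \<in> carrier (Ge e)"
          "r = reduce_word [(Inr e, True), (Inl (t e, \<omega> e a), True), (Inr e, False), (Inl (o' e, \<alpha> e a), False)]"
        | e where "e \<in> T" "r = [(Inr e, True)]"
        using r unfolding gog_relators_def by blast
      then show ?thesis
      proof cases
        case (1 v g h)
        then have "lift_word H f r =
            (f (Inl (v, g)) \<otimes>\<^bsub>H\<^esub> f (Inl (v, h))) \<otimes>\<^bsub>H\<^esub> inv\<^bsub>H\<^esub> f (Inl (v, g \<otimes>\<^bsub>Gv v\<^esub> h))"
          by (simp add: lift letter_value_def vertex_mult_closed f' H.m_assoc)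
        then show ?thesis using vertex[OF 1(1-3)] 1 by (simp add: f')
      next
        case (2 e a)
        then have "lift_word H f r = (f (Inr e) \<otimes>\<^bsub>H\<^esub> f (Inl (t e, \<omega> e a))) \<otimes>\<^bsub>H\<^esub>
            inv\<^bsub>H\<^esub> (f (Inl (o' e, \<alpha> e a)) \<otimes>\<^bsub>H\<^esub> f (Inr e))"
          by (simp add: lift letter_value_def edge_maps_closed f' H.m_assoc H.inv_mult_group)
        then show ?thesis using edge[OF 2(1-2)] 2 by (simp add: f' edge_maps_closed)
      next
        case (3 e)
        then show ?thesis using tree_edge by (simp add: letter_value_def)
      qed
    qed
    then show "r \<in> kernel F H (lift_word H f)" using r rels_sub by (auto simp: kernel_def)
  qed
  then have ker: "NC \<subseteq> kernel F H (lift_word H f)"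
    by (rule F.normal_closure_minimal[OF h.normal_kernel])
  have "lift_word H f x = lift_word H f y"
    if xy: "x \<in> carrier F" "y \<in> carrier F" "NC #>\<^bsub>F\<^esub> x = NC #>\<^bsub>F\<^esub> y" for x y
  proof -
    have "x \<in> NC #>\<^bsub>F\<^esub> y" using F.rcos_self[OF xy(1) NC.subgroup_axioms] xy by simp
    then obtain n where n: "n \<in> NC" "x = n \<otimes>\<^bsub>F\<^esub> y" by (auto simp: r_coset_def)
    then have "n \<in> carrier F" "lift_word H f n = \<one>\<^bsub>H\<^esub>" using ker by (auto simp: kernel_def)
    then show ?thesis using n xy by simp
  qed
  then obtain h where "h \<in> hom (F Mod NC) H" "\<And>x. x \<in> carrier F \<Longrightarrow> h (NC #>\<^bsub>F\<^esub> x) = lift_word H f x"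
    using FactGroup_universal[OF h.homh NC.normal_axioms] by metis
  then show ?thesis
    by (intro bexI[of _ h]) (auto simp: G_def gen_def letter_value_def f')
qed

section \<open>The retraction, its section, and the conjugates of vertex groups\<close>

abbreviation Q where "Q \<equiv> free_group_on (E - T)"

sublocale Q: group Q by (rule group_free_group_on)

text \<open>The class of \<open>e\<close> in the fundamental group of the underlying graph, where
  the spanning tree is collapsed.\<close>

definition edge_word where "edge_word e = (if e \<in> T then [] else [(e, True)])"

lemma edge_word_closed [simp]: "e \<in> E \<Longrightarrow> edge_word e \<in> carrier Q"
  by (simp add: edge_word_def carrier_free_group_on)

text \<open>A section of the retraction onto \<open>Q\<close>; it needs no relations to be checked
  because \<open>Q\<close> is free.\<close>

definition sec where "sec = lift_word G (\<lambda>e. gen (Inr e))"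

lemma sec_hom: "sec \<in> hom Q G"
  unfolding sec_def by (rule G.lift_word_hom) auto

sublocale sec: group_hom Q G sec
  by unfold_locales (rule sec_hom)

lemma sec_edge_word: "e \<in> E \<Longrightarrow> sec (edge_word e) = gen (Inr e)"
  by (simp add: sec_def edge_word_def gen_tree letter_value_def)

text \<open>For \<open>x = (v, p)\<close> the image is the vertex group of the cover at the copy of
  \<open>v\<close> indexed by \<open>p\<close>.\<close>

definition conj_vertex where
  "conj_vertex x g = sec (snd x) \<otimes>\<^bsub>G\<^esub> gen (Inl (fst x, g)) \<otimes>\<^bsub>G\<^esub> inv\<^bsub>G\<^esub> sec (snd x)"

lemma conj_vertex_closed:
  "v \<in> V \<Longrightarrow> p \<in> carrier Q \<Longrightarrow> g \<in> carrier (Gv v) \<Longrightarrow> conj_vertex (v, p) g \<in> carrier G"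
  by (simp add: conj_vertex_def)

lemma conj_vertex_hom:
  assumes "v \<in> V" "p \<in> carrier Q"
  shows "conj_vertex (v, p) \<in> hom (Gv v) G"
proof (rule homI)
  fix g h assume gh: "g \<in> carrier (Gv v)" "h \<in> carrier (Gv v)"
  have "inv\<^bsub>G\<^esub> sec p \<otimes>\<^bsub>G\<^esub> (sec p \<otimes>\<^bsub>G\<^esub> y) = y" if "y \<in> carrier G" for y
    using that assms by (simp flip: G.m_assoc)
  then show "conj_vertex (v, p) (g \<otimes>\<^bsub>Gv v\<^esub> h) = conj_vertex (v, p) g \<otimes>\<^bsub>G\<^esub> conj_vertex (v, p) h"
    using assms gh by (simp add: conj_vertex_def gen_vertex G.m_assoc)
qed (simp add: conj_vertex_closed assms)

text \<open>The copy of \<open>e\<close> starting at \<open>(o' e, p)\<close> ends in the copy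
  indexed by \<open>p \<otimes> edge_word e\<close>. As \<open>sec\<close> turns this product into
  \<open>sec p\<close> times the stable letter, the edge relation identifies the two images of the
  edge group.\<close>

lemma conj_vertex_edge:
  assumes "e \<in> E" "p \<in> carrier Q" "a \<in> carrier (Ge e)"
  shows "conj_vertex (t e, p \<otimes>\<^bsub>Q\<^esub> edge_word e) (\<omega> e a) = conj_vertex (o' e, p) (\<alpha> e a)"
proof -
  let ?g = "gen (Inr e)" and ?x = "gen (Inl (t e, \<omega> e a))" and ?y = "gen (Inl (o' e, \<alpha> e a))"
  have "conj_vertex (t e, p \<otimes>\<^bsub>Q\<^esub> edge_word e) (\<omega> e a)
      = sec p \<otimes>\<^bsub>G\<^esub> (?g \<otimes>\<^bsub>G\<^esub> ?x) \<otimes>\<^bsub>G\<^esub> inv\<^bsub>G\<^esub> ?g \<otimes>\<^bsub>G\<^esub> inv\<^bsub>G\<^esub> sec p"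
    using assms by (simp add: conj_vertex_def sec_edge_word edge_maps_closed G.m_assoc G.inv_mult_group)
  also have "?g \<otimes>\<^bsub>G\<^esub> ?x = ?y \<otimes>\<^bsub>G\<^esub> ?g" by (rule gen_edge[OF assms(1,3)])
  also have "sec p \<otimes>\<^bsub>G\<^esub> (?y \<otimes>\<^bsub>G\<^esub> ?g) \<otimes>\<^bsub>G\<^esub> inv\<^bsub>G\<^esub> ?g \<otimes>\<^bsub>G\<^esub> inv\<^bsub>G\<^esub> sec p = conj_vertex (o' e, p) (\<alpha> e a)"
    using assms by (simp add: conj_vertex_def edge_maps_closed G.m_assoc)
  finally show ?thesis .
qed

lemma ex_retraction:
  "\<exists>\<kappa>\<in>hom G Q. (\<forall>v\<in>V. \<forall>g\<in>carrier (Gv v). \<kappa> (gen (Inl (v, g))) = \<one>\<^bsub>Q\<^esub>) \<and>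
    (\<forall>e\<in>E. \<kappa> (gen (Inr e)) = edge_word e)"
proof -
  let ?f = "\<lambda>x. case x of Inl _ \<Rightarrow> \<one>\<^bsub>Q\<^esub> | Inr e \<Rightarrow> edge_word e"
  have "\<exists>\<kappa>\<in>hom G Q. \<forall>x\<in>gens. \<kappa> (gen x) = ?f x"
    by (rule universal_property)
      (auto simp: Q.is_group edge_word_def one_free_group_on gog_generators_def carrier_free_group_on
        mult_free_group_on reduce_word_def)
  then obtain \<kappa> where \<kappa>: "\<kappa> \<in> hom G Q" "\<And>x. x \<in> gens \<Longrightarrow> \<kappa> (gen x) = ?f x" by blast
  show ?thesis
    by (rule bexI[of _ \<kappa>]) (simp_all add: \<kappa>)
qed

section \<open>Oriented edges and bases adapted to free factors\<close>

text \<open>The letter \<open>(e, True)\<close> traverses \<open>e\<close> from \<open>o' e\<close> to \<open>t e\<close>, the letter \<open>(e, False)\<close> backwards.\<close>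

definition src where "src l = (if snd l then o' (fst l) else t (fst l))"
definition tgt where "tgt l = (if snd l then t (fst l) else o' (fst l))"
definition smap where "smap l = (if snd l then \<alpha> (fst l) else \<omega> (fst l))"
definition tmap where "tmap l = (if snd l then \<omega> (fst l) else \<alpha> (fst l))"

lemma letter_ends: "fst l \<in> E \<Longrightarrow> src l \<in> V" "fst l \<in> E \<Longrightarrow> tgt l \<in> V"
  by (simp_all add: src_def tgt_def)

lemma letter_maps:
  assumes "fst l \<in> E"
  shows "smap l \<in> hom (Ge (fst l)) (Gv (src l))" "tmap l \<in> hom (Ge (fst l)) (Gv (tgt l))"
    "inj_on (tmap l) (carrier (Ge (fst l)))"
    "free_factor (tmap l ` carrier (Ge (fst l))) (Gv (tgt l))"
  using edge_maps[OF assms] by (simp_all add: src_def tgt_def smap_def tmap_def)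

text \<open>The complement of the edge group is a subgroup of a free group, hence free by
  \<open>nielsen_schreier\<close>. The two parts of the basis are kept apart because maps out of the
  vertex group will be prescribed on the first and chosen freely on the second.\<close>

lemma ex_split_basis:
  assumes l: "fst l \<in> E" and BE: "free_basis (Ge (fst l)) BE"
  shows "\<exists>B. free_basis (Gv (tgt l)) (tmap l ` BE \<union> B) \<and> tmap l ` BE \<inter> B = {}"
proof -
  let ?G = "Gv (tgt l)" and ?H = "tmap l ` carrier (Ge (fst l))"
  interpret Gt: group ?G by (rule vertex_group[OF letter_ends(2)[OF l]])
  obtain K where K: "internal_free_product ?G ?H K"
    using letter_maps(4)[OF l] by (auto simp: free_factor_def)
  then have H_sub: "subgroup ?H ?G" and K_sub: "subgroup K ?G" by (auto simp: internal_free_product_def)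
  obtain B0 where "free_basis ?G B0"
    using clean letter_ends(2)[OF l]
    by (auto simp: alg_clean_graph_of_free_groups_def is_fin_rank_free_group_def)
  then obtain B where B: "free_basis (?G\<lparr>carrier := K\<rparr>) B"
    using Gt.nielsen_schreier[OF _ K_sub] by (auto simp: is_free_group_def)
  have "tmap l \<in> iso (Ge (fst l)) (?G\<lparr>carrier := ?H\<rparr>)"
    using letter_maps[OF l] by (auto simp: iso_def bij_betw_def hom_def)
  then have "free_basis (?G\<lparr>carrier := ?H\<rparr>) (tmap l ` BE)"
    using free_basis_iso[OF edge_group[OF l] Gt.subgroup_imp_group[OF H_sub] _ BE] by blast
  from Gt.free_basis_internal_free_product[OF K this B] show ?thesis by blast
qed

end

section \<open>The kernel of the retraction onto the fundamental group of the graph\<close>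

text \<open>
  \<open>d r\<close> is the distance from \<open>r\<close> in the spanning tree and \<open>f r v\<close> the last letter of the path from \<open>r\<close>
  to \<open>v\<close>; \<open>BK l\<close> is a basis of a free complement of the edge group in the vertex group at the end
  of \<open>l\<close>.
\<close>

locale split_graph_of_groups = clean_graph_of_groups V E o' t Gv Ge \<alpha> \<omega> T
  for V :: "'v set" and E :: "'e set" and o' t :: "'e \<Rightarrow> 'v"
    and Gv :: "'v \<Rightarrow> 'a monoid" and Ge :: "'e \<Rightarrow> 'b monoid"
    and \<alpha> \<omega> :: "'e \<Rightarrow> 'b \<Rightarrow> 'a" and T :: "'e set" +
  fixes v0 :: 'v and d :: "'v \<Rightarrow> 'v \<Rightarrow> nat" and f :: "'v \<Rightarrow> 'v \<Rightarrow> 'e \<times> bool"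
    and B0 :: "'a set" and BE :: "'e \<Rightarrow> 'b set" and BK :: "'e \<times> bool \<Rightarrow> 'a set"
    and \<kappa> :: "((('v \<times> 'a) + 'e) \<times> bool) list set \<Rightarrow> ('e \<times> bool) list"
  assumes v0: "v0 \<in> V"
    and tree_parent: "\<And>r v. \<lbrakk>r \<in> V; v \<in> V - {r}\<rbrakk> \<Longrightarrow>
      fst (f r v) \<in> T \<and> tgt (f r v) = v \<and> src (f r v) \<in> V \<and> d r (src (f r v)) < d r v"
    and tree_cover: "\<And>r e. \<lbrakk>r \<in> V; e \<in> T\<rbrakk> \<Longrightarrow> \<exists>b. tgt (e, b) \<in> V - {r} \<and> f r (tgt (e, b)) = (e, b)"
    and root_basis: "free_basis (Gv v0) B0"
    and edge_basis: "\<And>e. e \<in> E \<Longrightarrow> free_basis (Ge e) (BE e)"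
    and split_basis: "\<And>l. fst l \<in> E \<Longrightarrow> free_basis (Gv (tgt l)) (tmap l ` BE (fst l) \<union> BK l)"
    and split_disjoint: "\<And>l. fst l \<in> E \<Longrightarrow> tmap l ` BE (fst l) \<inter> BK l = {}"
    and \<kappa>_hom: "\<kappa> \<in> hom G Q"
    and \<kappa>_vertex: "\<And>v g. \<lbrakk>v \<in> V; g \<in> carrier (Gv v)\<rbrakk> \<Longrightarrow> \<kappa> (gen (Inl (v, g))) = \<one>\<^bsub>Q\<^esub>"
    and \<kappa>_edge: "\<And>e. e \<in> E \<Longrightarrow> \<kappa> (gen (Inr e)) = edge_word e"
begin

sublocale \<kappa>: group_hom G Q \<kappa>
  by unfold_locales (rule \<kappa>_hom)

lemma \<kappa>_sec: assumes "q \<in> carrier Q" shows "\<kappa> (sec q) = q"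
proof -
  have q: "fst ` set q \<subseteq> E - T" "reduced_word q" using assms by (auto simp: carrier_free_group_on)
  have "\<kappa> (sec q) = lift_word Q (\<kappa> \<circ> (\<lambda>e. gen (Inr e))) q"
    unfolding sec_def using q by (intro \<kappa>.lift_word_comp[of _ "E - T"]) auto
  also have "\<dots> = lift_word Q (\<lambda>e. [(e, True)]) q"
    using q by (intro lift_word_cong) (force simp: \<kappa>_edge edge_word_def)
  also have "\<dots> = q" using q by (simp add: lift_word_free_group_on reduce_word_reduced)
  finally show ?thesis .
qed

section \<open>The cover as a rooted tree\<close>

text \<open>
  The copy of the spanning tree at \<open>p \<noteq> []\<close> hangs on the copy at \<open>butlast p\<close> by the edge \<open>last p\<close>, and
  is rooted at the end of that edge.
\<close>

definition tree_vertices where "tree_vertices = V \<times> carrier Q"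
definition root where "root = (v0, [] :: ('e \<times> bool) list)"
definition copy_root where "copy_root p = (if p = [] then v0 else tgt (last p))"
text \<open>At \<open>root\<close> the value is the unspecified \<open>last []\<close>; statements
  about parents exclude \<open>root\<close>.\<close>

definition parent_letter where
  "parent_letter = (\<lambda>(v, p). if v = copy_root p then last p else f (copy_root p) v)"
definition parent where
  "parent = (\<lambda>(v, p). (src (parent_letter (v, p)), if v = copy_root p then butlast p else p))"
text \<open>A parent lies either in the copy indexed by a shorter word, or in the same copy and
  nearer to its root; hence the lexicographic order.\<close>

definition depth_order where
  "depth_order = inv_image (less_than <*lex*> less_than) (\<lambda>(v, p). (length p, d (copy_root p) v))"

lemma wf_depth_order: "wf depth_order"
  unfolding depth_order_def by (intro wf_inv_image wf_lex_prod wf_less_than)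

lemma copy_root_in: "p \<in> carrier Q \<Longrightarrow> copy_root p \<in> V"
proof -
  assume p: "p \<in> carrier Q"
  have "fst (last p) \<in> E" if "p \<noteq> []"
    using p last_in_set[OF that] by (auto simp: carrier_free_group_on)
  then show ?thesis using v0 letter_ends by (simp add: copy_root_def)
qed

text \<open>The last clause brings the parent edge into the form required by
  \<open>conj_vertex_edge\<close>, based at the parent or at the child according to the direction of
  the letter. It covers edges of \<open>T\<close> as well, their class being trivial.\<close>

lemma parent_letter_props:
  assumes "(v, p) \<in> tree_vertices - {root}"
  shows "fst (parent_letter (v, p)) \<in> E" "tgt (parent_letter (v, p)) = v"
    "parent (v, p) \<in> tree_vertices" "(parent (v, p), (v, p)) \<in> depth_order"
    "fst (parent (v, p)) = src (parent_letter (v, p))"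
    "let e = fst (parent_letter (v, p)); p' = snd (parent (v, p)) in
      if snd (parent_letter (v, p)) then p = p' \<otimes>\<^bsub>Q\<^esub> edge_word e else p' = p \<otimes>\<^bsub>Q\<^esub> edge_word e"
proof -
  have v: "v \<in> V" and p: "p \<in> carrier Q" "reduced_word p" "fst ` set p \<subseteq> E - T"
    and ne: "(v, p) \<noteq> (v0, [])"
    using assms by (auto simp: tree_vertices_def root_def carrier_free_group_on)
  let ?l = "parent_letter (v, p)"
  show "fst (parent (v, p)) = src ?l" by (simp add: parent_def)
  have "fst ?l \<in> E \<and> tgt ?l = v \<and> parent (v, p) \<in> tree_vertices \<and> (parent (v, p), (v, p)) \<in> depth_order \<and>
    (let e = fst ?l; p' = snd (parent (v, p)) in
      if snd ?l then p = p' \<otimes>\<^bsub>Q\<^esub> edge_word e else p' = p \<otimes>\<^bsub>Q\<^esub> edge_word e)"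
  proof (cases "v = copy_root p")
    case True
    then have "p \<noteq> []" using ne by (auto simp: copy_root_def)
    then obtain p' e b where pe: "p = p' @ [(e, b)]" by (metis prod.exhaust rev_exhaust)
    then have e: "e \<in> E - T" "reduced_word p'" "fst ` set p' \<subseteq> E - T"
      using p reduced_word_appendD[of p'] by auto
    have l: "?l = (e, b)" "parent (v, p) = (src (e, b), p')" "tgt (e, b) = v"
      using True pe by (simp_all add: parent_letter_def parent_def copy_root_def)
    have p': "p' \<in> carrier Q" "[(e, b)] \<in> carrier Q" using e by (auto simp: carrier_free_group_on)
    have p_eq: "p = p' \<otimes>\<^bsub>Q\<^esub> [(e, b)]"
      using p(2) pe by (simp add: mult_free_group_on reduce_word_reduced)
    have "p \<otimes>\<^bsub>Q\<^esub> [(e, True)] = p'" if "\<not> b"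
    proof -
      have "[(e, True)] = inv\<^bsub>Q\<^esub> [(e, b)]" using e that by (simp add: inv_singleton_free_group_on)
      then show ?thesis using p' by (simp add: p_eq Q.m_assoc)
    qed
    then have "let e' = fst ?l; p'' = snd (parent (v, p)) in
        if snd ?l then p = p'' \<otimes>\<^bsub>Q\<^esub> edge_word e' else p'' = p \<otimes>\<^bsub>Q\<^esub> edge_word e'"
      using e p_eq unfolding l by (cases b) (simp_all add: edge_word_def)
    moreover have "(parent (v, p), (v, p)) \<in> depth_order"
      unfolding l by (simp add: depth_order_def pe)
    moreover have "parent (v, p) \<in> tree_vertices"
      unfolding l using letter_ends[of "(e, b)"] e p' by (simp add: tree_vertices_def)
    ultimately show ?thesis using l(1,3) e by simp
  next
    case False
    then have "fst (f (copy_root p) v) \<in> T" "tgt (f (copy_root p) v) = v" "src (f (copy_root p) v) \<in> V"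
        "d (copy_root p) (src (f (copy_root p) v)) < d (copy_root p) v"
      using tree_parent[OF copy_root_in[OF p(1)], of v] v by auto
    then show ?thesis
      using False T_sub p
      by (auto simp: parent_letter_def parent_def tree_vertices_def depth_order_def edge_word_def
          simp flip: one_free_group_on[of "E - T"])
  qed
  then show "fst ?l \<in> E" "tgt ?l = v" "parent (v, p) \<in> tree_vertices"
    "(parent (v, p), (v, p)) \<in> depth_order"
    "let e = fst ?l; p' = snd (parent (v, p)) in
      if snd ?l then p = p' \<otimes>\<^bsub>Q\<^esub> edge_word e else p' = p \<otimes>\<^bsub>Q\<^esub> edge_word e"
    by blast+
qed

text \<open>The new letters contributed by \<open>x\<close>: a full basis at the root, elsewhere a
  basis of the complement of the edge group shared with the parent.\<close>

definition basis where "basis x = (if x = root then B0 else BK (parent_letter x))"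

lemma conj_vertex_parent:
  assumes x: "x \<in> tree_vertices - {root}" and a: "a \<in> carrier (Ge (fst (parent_letter x)))"
  shows "conj_vertex x (tmap (parent_letter x) a) = conj_vertex (parent x) (smap (parent_letter x) a)"
proof -
  obtain v p v' p' e b where eqs: "x = (v, p)" "parent x = (v', p')" "parent_letter x = (e, b)"
    by (metis prod.exhaust)
  note props = parent_letter_props[of v p, folded eqs(1), OF x, unfolded eqs(2,3)]
  have "p \<in> carrier Q" "p' \<in> carrier Q" using x props(3) by (auto simp: eqs tree_vertices_def)
  moreover have "a \<in> carrier (Ge e)" using a unfolding eqs(3) by simp
  ultimately have "conj_vertex (v, p) (tmap (e, b) a) = conj_vertex (v', p') (smap (e, b) a)"
    using props(1,2,5,6) conj_vertex_edge[of e p a] conj_vertex_edge[of e p' a]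
    by (cases b) (simp_all add: tmap_def smap_def src_def tgt_def)
  then show ?thesis unfolding eqs(2,3) unfolding eqs(1) .
qed

section \<open>Maps from the vertex groups of the cover to the candidate free group\<close>

definition Z where "Z = Sigma tree_vertices basis"
abbreviation FZ where "FZ \<equiv> free_group_on Z"

sublocale FZ: group FZ by (rule group_free_group_on)

text \<open>On the basis of the edge group the map is dictated by \<open>y\<close>; each
  complementary basis element goes to a letter of its own. Disjointness of the two parts makes this
  consistent, and agreement on a basis of the edge group gives agreement on all of it.\<close>

lemma ex_step:
  assumes x: "x \<in> tree_vertices - {root}" and y: "y \<in> hom (Gv (fst (parent x))) FZ"
  shows "\<exists>h\<in>hom (Gv (fst x)) FZ. (\<forall>b\<in>basis x. h b = [((x, b), True)]) \<and>
    (\<forall>a\<in>carrier (Ge (fst (parent_letter x))).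
      h (tmap (parent_letter x) a) = y (smap (parent_letter x) a))"
proof -
  obtain v p where vp: "x = (v, p)" by (cases x)
  let ?l = "parent_letter x"
  let ?e = "fst ?l"
  note props = parent_letter_props[of v p, folded vp, OF x]
  have v: "v \<in> V" using x vp by (auto simp: tree_vertices_def)
  interpret Gv: group "Gv v" by (rule vertex_group[OF v])
  interpret Ge: group "Ge ?e" by (rule edge_group[OF props(1)])
  have y': "y \<in> hom (Gv (src ?l)) FZ" using y props(5) by simp
  have BE: "BE ?e \<subseteq> carrier (Ge ?e)" "generate (Ge ?e) (BE ?e) = carrier (Ge ?e)"
    using edge_basis[OF props(1)] by (auto simp: free_basis_def)
  have inj: "inj_on (tmap ?l) (BE ?e)"
    using letter_maps(3)[OF props(1)] BE(1) by (rule inj_on_subset)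
  define g where "g b = (if b \<in> BK ?l then [((x, b), True)]
    else y (smap ?l (inv_into (BE ?e) (tmap ?l) b)))" for b
  have bas: "basis x = BK ?l" using x by (simp add: basis_def)
  have g_tmap: "g (tmap ?l a) = y (smap ?l a)" if "a \<in> BE ?e" for a
    using that inj split_disjoint[OF props(1)] by (auto simp: g_def)
  have comp: "y \<circ> smap ?l \<in> hom (Ge ?e) FZ"
    using letter_maps(1)[OF props(1)] y' by (rule Group.hom_compose)
  have g: "g \<in> tmap ?l ` BE ?e \<union> BK ?l \<rightarrow> carrier FZ"
  proof (rule Pi_I)
    fix b assume b: "b \<in> tmap ?l ` BE ?e \<union> BK ?l"
    show "g b \<in> carrier FZ"
    proof (cases "b \<in> BK ?l")
      case True
      then show ?thesis using x bas by (simp add: g_def Z_def)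
    next
      case False
      then obtain a where "b = tmap ?l a" "a \<in> BE ?e" using b by auto
      then show ?thesis using hom_in_carrier[OF comp, of a] BE(1) by (auto simp: g_tmap)
    qed
  qed
  obtain h where h: "h \<in> hom (Gv v) FZ" "\<And>b. b \<in> tmap ?l ` BE ?e \<union> BK ?l \<Longrightarrow> h b = g b"
    using Gv.free_basis_extend[OF _ FZ.is_group g] split_basis[OF props(1)] props(2) by auto
  have "h (tmap ?l a) = y (smap ?l a)" if "a \<in> carrier (Ge ?e)" for a
  proof -
    have "h \<circ> tmap ?l \<in> hom (Ge ?e) FZ"
      using letter_maps(2)[OF props(1)] h(1) unfolding props(2) by (rule Group.hom_compose)
    then have "(h \<circ> tmap ?l) a = (y \<circ> smap ?l) a"
      by (rule Ge.hom_eq_on_generate[OF FZ.is_group _ comp BE(1)]) (use h(2) g_tmap BE that in auto)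
    then show ?thesis by simp
  qed
  moreover have "h b = [((x, b), True)]" if "b \<in> basis x" for b
    using h(2)[of b] that bas by (simp add: g_def)
  moreover have "h \<in> hom (Gv (fst x)) FZ" using h(1) vp by simp
  ultimately show ?thesis by blast
qed

text \<open>A candidate inverse, one vertex group at a time: \<open>\<theta> x\<close> is meant to
  write the conjugate at \<open>x\<close> in the letters of \<open>Z\<close>.\<close>

lemma ex_vertex_maps:
  "\<exists>\<theta>. (\<forall>x\<in>tree_vertices. \<theta> x \<in> hom (Gv (fst x)) FZ \<and> (\<forall>b\<in>basis x. \<theta> x b = [((x, b), True)])) \<and>
    (\<forall>x\<in>tree_vertices - {root}. \<forall>a\<in>carrier (Ge (fst (parent_letter x))).
      \<theta> x (tmap (parent_letter x) a) = \<theta> (parent x) (smap (parent_letter x) a))"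
proof -
  interpret Gv0: group "Gv v0" by (rule vertex_group[OF v0])
  have root_in: "root \<in> tree_vertices"
    using v0 by (simp add: root_def tree_vertices_def carrier_free_group_on)
  then have "(\<lambda>b. [((root, b), True)]) \<in> B0 \<rightarrow> carrier FZ" by (auto simp: Z_def basis_def)
  then obtain h0 where h0: "h0 \<in> hom (Gv v0) FZ" "\<And>b. b \<in> B0 \<Longrightarrow> h0 b = [((root, b), True)]"
    using Gv0.free_basis_extend[OF root_basis FZ.is_group] by blast
  define P where "P x y h \<longleftrightarrow> h \<in> hom (Gv (fst x)) FZ \<and> (\<forall>b\<in>basis x. h b = [((x, b), True)]) \<and>
    (\<forall>a\<in>carrier (Ge (fst (parent_letter x))).
      h (tmap (parent_letter x) a) = y (smap (parent_letter x) a))" for x y h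
  have step: "P x y (SOME h. P x y h)"
    if "x \<in> tree_vertices - {root}" "y \<in> hom (Gv (fst (parent x))) FZ" for x y
    using ex_step[OF that] unfolding P_def Bex_def by (rule someI_ex)
  \<comment> \<open>The default \<open>h0\<close> is meant for the root; points outside
    \<open>tree_vertices\<close> receive it too, but nothing is claimed there.\<close>
  have "\<exists>\<theta>. \<forall>x. \<theta> x = (if x \<in> tree_vertices - {root} then SOME h. P x (\<theta> (parent x)) h else h0)"
    by (rule tree_recursion[OF wf_depth_order]) (metis parent_letter_props(4) prod.exhaust)
  then obtain \<theta> where \<theta>: "\<And>x. \<theta> x = (if x \<in> tree_vertices - {root}
      then SOME h. P x (\<theta> (parent x)) h else h0)" by blast
  have \<theta>_root: "\<theta> root = h0" by (subst \<theta>) simp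
  have \<theta>_step: "P x (\<theta> (parent x)) (\<theta> x)"
    if "x \<in> tree_vertices - {root}" "\<theta> (parent x) \<in> hom (Gv (fst (parent x))) FZ" for x
    using step[OF that] that(1) by (subst (2) \<theta>) simp
  \<comment> \<open>\<open>SOME\<close> is known to pick a suitable map only if the parent's map is
    a homomorphism, so this property has to be carried along the tree by its own induction.\<close>
  have hom: "\<theta> x \<in> hom (Gv (fst x)) FZ" if "x \<in> tree_vertices" for x
    using wf_depth_order that
  proof (induction x rule: wf_induct_rule)
    case (less x)
    show ?case
    proof (cases "x = root")
      case True
      then show ?thesis using h0 by (simp add: \<theta>_root) (simp add: root_def)
    next
      case False
      then have x: "x \<in> tree_vertices - {root}" using less.prems by simp
      then have "(parent x, x) \<in> depth_order" "parent x \<in> tree_vertices"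
        using parent_letter_props(3,4) by (metis prod.exhaust)+
      from \<theta>_step[OF x less.IH[OF this]] show ?thesis by (simp add: P_def)
    qed
  qed
  have all: "P x (\<theta> (parent x)) (\<theta> x)" if "x \<in> tree_vertices - {root}" for x
    using \<theta>_step[OF that hom] parent_letter_props(3) that by (metis prod.exhaust)
  show ?thesis
  proof (intro exI[of _ \<theta>] conjI ballI)
    fix x b assume "x \<in> tree_vertices" "b \<in> basis x"
    then show "\<theta> x b = [((x, b), True)]"
      using all[of x] h0(2) \<theta>_root by (cases "x = root") (auto simp: P_def basis_def)
  qed (use hom all in \<open>auto simp: P_def\<close>)
qed

text \<open>Each edge of the cover is the parent edge of one of its ends, so agreement along parent
  edges is agreement along all edges. For copies of edges in \<open>T\<close> this is
  \<open>tree_cover\<close>.\<close>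

lemma edge_compatible:
  assumes \<theta>: "\<And>x a. \<lbrakk>x \<in> tree_vertices - {root}; a \<in> carrier (Ge (fst (parent_letter x)))\<rbrakk> \<Longrightarrow>
      \<theta> x (tmap (parent_letter x) a) = \<theta> (parent x) (smap (parent_letter x) a)"
    and e: "e \<in> E" and p: "p \<in> carrier Q" and a: "a \<in> carrier (Ge e)"
  shows "\<theta> (t e, p \<otimes>\<^bsub>Q\<^esub> edge_word e) (\<omega> e a) = \<theta> (o' e, p) (\<alpha> e a)"
proof (cases "e \<in> T")
  case True
  then obtain b where b: "tgt (e, b) \<in> V - {copy_root p}" "f (copy_root p) (tgt (e, b)) = (e, b)"
    using tree_cover[OF copy_root_in[OF p]] by blast
  let ?x = "(tgt (e, b), p)"
  have "?x \<in> tree_vertices - {root}"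
    using b p by (auto simp: tree_vertices_def root_def copy_root_def)
  moreover have "parent_letter ?x = (e, b)" "parent ?x = (src (e, b), p)"
    using b by (auto simp: parent_letter_def parent_def)
  moreover have "p \<otimes>\<^bsub>Q\<^esub> edge_word e = p"
    using True p by (simp add: edge_word_def flip: one_free_group_on[of "E - T"])
  ultimately show ?thesis
    using \<theta>[of ?x a] a by (cases b) (simp_all add: tmap_def smap_def src_def tgt_def)
next
  case False
  then have e': "[(e, True)] \<in> carrier Q" "[(e, False)] \<in> carrier Q" and ew: "edge_word e = [(e, True)]"
    using e by (auto simp: edge_word_def)
  have red: "reduced_word p" "fst ` set p \<subseteq> E - T" using p by (auto simp: carrier_free_group_on)
  show ?thesis
  \<comment> \<open>If \<open>p\<close> ends in the inverse letter, crossing \<open>e\<close>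
    cancels it and \<open>(o' e, p)\<close> is the child. Otherwise \<open>e\<close> prolongs
    \<open>p\<close> to a reduced word and the child is the other end.\<close>
  proof (cases "\<exists>p'. p = p' @ [(e, False)]")
    case True
    then obtain p' where p': "p = p' @ [(e, False)]" by blast
    have "(o' e, p) \<in> tree_vertices - {root}" "parent_letter (o' e, p) = (e, False)"
      "parent (o' e, p) = (t e, p')"
      using p e p' by (auto simp: tree_vertices_def root_def parent_letter_def parent_def copy_root_def src_def tgt_def)
    moreover have "p \<otimes>\<^bsub>Q\<^esub> [(e, True)] = p'"
      using parent_letter_props(6)[OF calculation(1)] calculation ew by simp
    ultimately show ?thesis
      using \<theta>[of "(o' e, p)" a] a by (simp add: tmap_def smap_def ew)
  next
    case notTrue: False
    then have "p = [] \<or> last p \<noteq> (e, False)" by (metis append_butlast_last_id)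
    then have red': "reduced_word (p @ [(e, True)])" using red by (simp add: reduced_word_snoc)
    let ?x = "(t e, p @ [(e, True)])"
    have "?x \<in> tree_vertices - {root}" "parent_letter ?x = (e, True)" "parent ?x = (o' e, p)"
      using e red red' False
      by (auto simp: tree_vertices_def root_def parent_letter_def parent_def copy_root_def src_def tgt_def
          carrier_free_group_on)
    moreover have "p \<otimes>\<^bsub>Q\<^esub> [(e, True)] = p @ [(e, True)]"
      using red' by (simp add: mult_free_group_on reduce_word_reduced)
    ultimately show ?thesis
      using \<theta>[of ?x a] a by (simp add: tmap_def smap_def ew)
  qed
qed

section \<open>The action that detects freeness of the kernel\<close>

text \<open>The point \<open>(p, n)\<close> stands for the product of the inverse of \<open>p\<close> with \<open>n\<close>, which explains both formulas.\<close>

lemma ex_action: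
  "\<exists>\<rho>\<in>hom G (BijGroup (carrier Q \<times> carrier FZ)). \<exists>\<theta>.
    (\<forall>x\<in>tree_vertices. \<forall>b\<in>basis x. \<theta> x b = [((x, b), True)]) \<and>
    (\<forall>v\<in>V. \<forall>g\<in>carrier (Gv v). \<forall>p\<in>carrier Q. \<forall>n\<in>carrier FZ.
      \<rho> (gen (Inl (v, g))) (p, n) = (p, \<theta> (v, p) g \<otimes>\<^bsub>FZ\<^esub> n)) \<and>
    (\<forall>e\<in>E. \<forall>p\<in>carrier Q. \<forall>n\<in>carrier FZ.
      \<rho> (gen (Inr e)) (p, n) = (p \<otimes>\<^bsub>Q\<^esub> inv\<^bsub>Q\<^esub> edge_word e, n))"
proof -
  define S where "S = carrier Q \<times> carrier FZ"
  obtain \<theta> where \<theta>_hom: "\<And>x. x \<in> tree_vertices \<Longrightarrow> \<theta> x \<in> hom (Gv (fst x)) FZ"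
    and \<theta>_basis: "\<And>x b. \<lbrakk>x \<in> tree_vertices; b \<in> basis x\<rbrakk> \<Longrightarrow> \<theta> x b = [((x, b), True)]"
    and \<theta>_parent: "\<And>x a. \<lbrakk>x \<in> tree_vertices - {root}; a \<in> carrier (Ge (fst (parent_letter x)))\<rbrakk> \<Longrightarrow>
      \<theta> x (tmap (parent_letter x) a) = \<theta> (parent x) (smap (parent_letter x) a)"
    using ex_vertex_maps by blast
  have \<theta>: "\<theta> (v, p) g \<in> carrier FZ"
    "h \<in> carrier (Gv v) \<Longrightarrow> \<theta> (v, p) (g \<otimes>\<^bsub>Gv v\<^esub> h) = \<theta> (v, p) g \<otimes>\<^bsub>FZ\<^esub> \<theta> (v, p) h"
    if "v \<in> V" "p \<in> carrier Q" "g \<in> carrier (Gv v)" for v p g h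
    using \<theta>_hom[of "(v, p)"] that by (auto simp: tree_vertices_def hom_mult intro: hom_in_carrier)
  define act where "act x = (case x of
      Inl vg \<Rightarrow> \<lambda>(p, n). (p, \<theta> (fst vg, p) (snd vg) \<otimes>\<^bsub>FZ\<^esub> n)
    | Inr e \<Rightarrow> \<lambda>(p, n). (p \<otimes>\<^bsub>Q\<^esub> inv\<^bsub>Q\<^esub> edge_word e, n))" for x
  define act' where "act' x = (case x of
      Inl vg \<Rightarrow> \<lambda>(p, n). (p, inv\<^bsub>FZ\<^esub> \<theta> (fst vg, p) (snd vg) \<otimes>\<^bsub>FZ\<^esub> n)
    | Inr e \<Rightarrow> \<lambda>(p, n). (p \<otimes>\<^bsub>Q\<^esub> edge_word e, n))" for x
  have act_closed: "restrict (act x) S \<in> carrier (BijGroup S)" if "x \<in> gens" for x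
  proof (rule restrict_in_Bij[of _ _ "act' x"])
    show "act x \<in> S \<rightarrow> S" "act' x \<in> S \<rightarrow> S"
      using that by (auto simp: gog_generators_def act_def act'_def S_def \<theta>)
    show "act' x (act x y) = y" "act x (act' x y) = y" if "y \<in> S" for y
      using that \<open>x \<in> gens\<close>
      by (auto simp: gog_generators_def act_def act'_def S_def \<theta> Q.m_assoc simp flip: FZ.m_assoc)
  qed
  have act_mult: "(restrict (act x) S \<otimes>\<^bsub>BijGroup S\<^esub> restrict (act y) S) z = act x (act y z)"
    if "x \<in> gens" "y \<in> gens" "z \<in> S" for x y z
    using that act_closed BijGroup_closed[OF act_closed, of y z] by (simp add: mult_BijGroup_apply)
  have "\<exists>\<rho>\<in>hom G (BijGroup S). \<forall>x\<in>gens. \<rho> (gen x) = restrict (act x) S"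
  proof (rule universal_property[OF group_BijGroup])
    show "(\<lambda>x. restrict (act x) S) \<in> gens \<rightarrow> carrier (BijGroup S)" using act_closed by auto
  next
    fix v g h assume v: "v \<in> V" "g \<in> carrier (Gv v)" "h \<in> carrier (Gv v)"
    let ?gh = "g \<otimes>\<^bsub>Gv v\<^esub> h"
    show "restrict (act (Inl (v, ?gh))) S =
      restrict (act (Inl (v, g))) S \<otimes>\<^bsub>BijGroup S\<^esub> restrict (act (Inl (v, h))) S"
    proof (rule BijGroup_eqI[of _ S])
      fix z assume "z \<in> S"
      then show "restrict (act (Inl (v, ?gh))) S z =
          (restrict (act (Inl (v, g))) S \<otimes>\<^bsub>BijGroup S\<^esub> restrict (act (Inl (v, h))) S) z"
        using v vertex_mult_closed[OF v] unfolding act_mult[OF Inl_gens[THEN iffD2, OF conjI[OF v(1,2)]]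
            Inl_gens[THEN iffD2, OF conjI[OF v(1,3)]] \<open>z \<in> S\<close>]
        by (auto simp: act_def S_def \<theta> FZ.m_assoc)
    qed (use v in \<open>auto intro!: act_closed monoid.m_closed[OF group.is_monoid[OF group_BijGroup]] vertex_mult_closed\<close>)
  next
    fix e a assume e: "e \<in> E" "a \<in> carrier (Ge e)"
    let ?e = "restrict (act (Inr e)) S" and ?\<omega> = "restrict (act (Inl (t e, \<omega> e a))) S"
      and ?\<alpha> = "restrict (act (Inl (o' e, \<alpha> e a))) S"
    show "?e \<otimes>\<^bsub>BijGroup S\<^esub> ?\<omega> = ?\<alpha> \<otimes>\<^bsub>BijGroup S\<^esub> ?e"
    proof (rule BijGroup_eqI[of _ S])
      fix z assume z: "z \<in> S"
      then obtain p n where pn: "z = (p, n)" "p \<in> carrier Q" "n \<in> carrier FZ" by (auto simp: S_def)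
      \<comment> \<open>Both sides move the first coordinate to \<open>?p\<close>. The second
        coordinates agree by compatibility along the copy of \<open>e\<close> that leads from
        \<open>(o' e, ?p)\<close> to \<open>(t e, p)\<close>.\<close>
      let ?p = "p \<otimes>\<^bsub>Q\<^esub> inv\<^bsub>Q\<^esub> edge_word e"
      have p: "?p \<in> carrier Q" using pn e by simp
      have "\<theta> (t e, ?p \<otimes>\<^bsub>Q\<^esub> edge_word e) (\<omega> e a) = \<theta> (o' e, ?p) (\<alpha> e a)"
        using \<theta>_parent e(1) p e(2) by (rule edge_compatible)
      moreover have "?p \<otimes>\<^bsub>Q\<^esub> edge_word e = p" using pn e by (simp add: Q.m_assoc)
      ultimately show "(?e \<otimes>\<^bsub>BijGroup S\<^esub> ?\<omega>) z = (?\<alpha> \<otimes>\<^bsub>BijGroup S\<^esub> ?e) z"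
        using e z by (simp add: act_mult edge_maps_closed) (simp add: act_def pn)
    qed (use e in \<open>auto intro!: act_closed monoid.m_closed[OF group.is_monoid[OF group_BijGroup]] simp: edge_maps_closed\<close>)
  next
    fix e assume e: "e \<in> T"
    then have "e \<in> E" using T_sub by auto
    show "restrict (act (Inr e)) S = \<one>\<^bsub>BijGroup S\<^esub>"
    proof (rule BijGroup_eqI[of _ S])
      fix z assume "z \<in> S"
      moreover have "p \<otimes>\<^bsub>Q\<^esub> inv\<^bsub>Q\<^esub> edge_word e = p" if "p \<in> carrier Q" for p
      proof -
        have "edge_word e = \<one>\<^bsub>Q\<^esub>" using e by (simp add: edge_word_def one_free_group_on)
        then show ?thesis using that by simp
      qed
      ultimately show "restrict (act (Inr e)) S z = \<one>\<^bsub>BijGroup S\<^esub> z"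
        by (auto simp: one_BijGroup_apply act_def S_def)
    qed (use \<open>e \<in> E\<close> in \<open>auto intro!: act_closed monoid.one_closed[OF group.is_monoid[OF group_BijGroup]]\<close>)
  qed
  then obtain \<rho> where \<rho>: "\<rho> \<in> hom G (BijGroup S)" "\<And>x. x \<in> gens \<Longrightarrow> \<rho> (gen x) = restrict (act x) S"
    by blast
  show ?thesis
    unfolding S_def[symmetric]
    by (intro bexI[of _ \<rho>] exI[of _ \<theta>]) (use \<rho> in \<open>auto simp: \<theta>_basis act_def S_def\<close>)
qed

section \<open>A free basis of the kernel\<close>

definition kernel_basis where "kernel_basis = (\<lambda>(x, b). conj_vertex x b)"

lemma basis_closed:
  assumes "(v, p) \<in> tree_vertices"
  shows "basis (v, p) \<subseteq> carrier (Gv v)"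
proof (cases "(v, p) = root")
  case True
  then show ?thesis using root_basis by (simp add: basis_def free_basis_def root_def)
next
  case False
  then have "(v, p) \<in> tree_vertices - {root}" using assms by simp
  note props = parent_letter_props(1,2)[OF this]
  show ?thesis
    using split_basis[OF props(1)] False unfolding props(2) by (simp add: basis_def free_basis_def)
qed

lemma kernel_basis_closed: "kernel_basis \<in> Z \<rightarrow> carrier G"
proof
  fix z assume "z \<in> Z"
  then obtain v p b where z: "z = ((v, p), b)" "(v, p) \<in> tree_vertices" "b \<in> basis (v, p)"
    by (auto simp: Z_def)
  then have "v \<in> V" "p \<in> carrier Q" "b \<in> carrier (Gv v)"
    using basis_closed by (auto simp: tree_vertices_def)
  then show "kernel_basis z \<in> carrier G" by (simp add: kernel_basis_def z conj_vertex_closed)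
qed

text \<open>The base point of \<open>Q\<close> is its identity. The inverse of \<open>sec p\<close>
  moves it to \<open>p\<close>, where the basis element \<open>b\<close> of the vertex group at
  \<open>(v, p)\<close> prepends the letter \<open>((v, p), b)\<close>, and \<open>sec p\<close>
  moves it back.\<close>

lemma kernel_basis_free:
  assumes w: "reduced_word w" "w \<noteq> []" "fst ` set w \<subseteq> Z"
  shows "lift_word G kernel_basis w \<noteq> \<one>\<^bsub>G\<^esub>"
proof -
  let ?S = "carrier Q \<times> carrier FZ"
  obtain \<rho> \<theta> where \<rho>: "\<rho> \<in> hom G (BijGroup ?S)"
    and \<theta>: "\<And>x b. \<lbrakk>x \<in> tree_vertices; b \<in> basis x\<rbrakk> \<Longrightarrow> \<theta> x b = [((x, b), True)]"
    and \<rho>_vertex: "\<And>v g p n. \<lbrakk>v \<in> V; g \<in> carrier (Gv v); p \<in> carrier Q; n \<in> carrier FZ\<rbrakk> \<Longrightarrow>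
      \<rho> (gen (Inl (v, g))) (p, n) = (p, \<theta> (v, p) g \<otimes>\<^bsub>FZ\<^esub> n)"
    and \<rho>_edge: "\<And>e p n. \<lbrakk>e \<in> E; p \<in> carrier Q; n \<in> carrier FZ\<rbrakk> \<Longrightarrow>
      \<rho> (gen (Inr e)) (p, n) = (p \<otimes>\<^bsub>Q\<^esub> inv\<^bsub>Q\<^esub> edge_word e, n)"
    using ex_action by blast
  note act = G.action_hom[OF \<rho>]
  \<comment> \<open>\<open>sec q\<close> translates the first coordinate and leaves the second
    alone, because stable letters do so.\<close>
  have \<rho>_sec: "\<rho> (sec q) (p, n) = (p \<otimes>\<^bsub>Q\<^esub> inv\<^bsub>Q\<^esub> q, n)"
    if "q \<in> carrier Q" "p \<in> carrier Q" "n \<in> carrier FZ" for q p n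
  proof -
    let ?B = "(\<lambda>e. [(e, True)]) ` (E - T)"
    have B: "?B \<subseteq> carrier Q" "generate Q ?B = carrier Q"
      using free_basis_free_group_on[of "E - T"] by (auto simp: free_basis_def)
    have letter: "\<rho> (sec q) (p, n) = (p \<otimes>\<^bsub>Q\<^esub> inv\<^bsub>Q\<^esub> q, n)"
      if "q \<in> ?B" "p \<in> carrier Q" "n \<in> carrier FZ" for q p n
    proof -
      obtain e where e: "e \<in> E - T" "q = edge_word e" using \<open>q \<in> ?B\<close> by (auto simp: edge_word_def)
      then show ?thesis using that by (simp add: sec_edge_word \<rho>_edge)
    qed
    from that(1) have "q \<in> generate Q ?B" using B by simp
    then show ?thesis
      using that(2,3)
    proof (induction arbitrary: p n)
      case one
      then show ?case using act(3)[of "(p, n)" "\<one>\<^bsub>G\<^esub>"] by simp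
    next
      case (incl q)
      then show ?case by (rule letter)
    next
      case (inv q)
      then have q: "q \<in> carrier Q" using B by auto
      have "\<rho> (sec q) (p \<otimes>\<^bsub>Q\<^esub> q, n) = (p, n)"
        using letter[OF inv(1), of "p \<otimes>\<^bsub>Q\<^esub> q" n] q inv by (simp add: Q.m_assoc)
      then show ?case
        using act(4)[of "(p \<otimes>\<^bsub>Q\<^esub> q, n)" "sec q"] q inv by simp
    next
      case (eng q r)
      then have qr: "q \<in> carrier Q" "r \<in> carrier Q" using B by auto
      then show ?case
        using act(2)[of "(p, n)" "sec q" "sec r"] eng.prems eng.IH
        by (simp add: Q.inv_mult_group Q.m_assoc)
    qed
  qed
  show ?thesis
  proof (rule G.lift_word_nontrivial[OF kernel_basis_closed \<rho> _ _ w])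
    show "(\<one>\<^bsub>Q\<^esub>, n) \<in> ?S" if "n \<in> carrier FZ" for n using that by simp
    fix xb n assume xb: "xb \<in> Z" and n: "n \<in> carrier FZ"
    then obtain v p b where eq: "xb = ((v, p), b)" "(v, p) \<in> tree_vertices" "b \<in> basis (v, p)"
      by (auto simp: Z_def)
    then have v: "v \<in> V" "p \<in> carrier Q" "b \<in> carrier (Gv v)"
      using basis_closed by (auto simp: tree_vertices_def)
    let ?n = "[(xb, True)] \<otimes>\<^bsub>FZ\<^esub> n"
    have n': "?n \<in> carrier FZ" using xb n by simp
    have "\<rho> (sec p) (p, n) = (\<one>\<^bsub>Q\<^esub>, n)" "\<rho> (sec p) (p, ?n) = (\<one>\<^bsub>Q\<^esub>, ?n)"
      using v n n' by (simp_all add: \<rho>_sec)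
    moreover have "\<rho> (inv\<^bsub>G\<^esub> sec p) (\<one>\<^bsub>Q\<^esub>, n) = (p, n)"
      using act(4)[of "(p, n)" "sec p"] calculation v n by simp
    moreover have "\<rho> (gen (Inl (v, b))) (p, n) = (p, ?n)"
      using v n eq by (simp add: \<rho>_vertex \<theta>)
    moreover have "\<rho> (kernel_basis xb) (\<one>\<^bsub>Q\<^esub>, n) =
        \<rho> (sec p) (\<rho> (gen (Inl (v, b))) (\<rho> (inv\<^bsub>G\<^esub> sec p) (\<one>\<^bsub>Q\<^esub>, n)))"
      using act(1,2) v n by (simp add: kernel_basis_def conj_vertex_def eq)
    ultimately show "\<rho> (kernel_basis xb) (\<one>\<^bsub>Q\<^esub>, n) = (\<one>\<^bsub>Q\<^esub>, ?n)" by simp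
  qed
qed

text \<open>Induction outwards from the root: the edge group part of the basis already lies in the
  conjugate at the parent by \<open>conj_vertex_parent\<close>, and the complementary part consists
  of candidates.\<close>

lemma conj_vertex_generated:
  assumes "x \<in> tree_vertices" "g \<in> carrier (Gv (fst x))"
  shows "conj_vertex x g \<in> generate G (kernel_basis ` Z)"
  using wf_depth_order assms
proof (induction x arbitrary: g rule: wf_induct_rule)
  case (less x)
  let ?L = "generate G (kernel_basis ` Z)"
  have L: "subgroup ?L G" using kernel_basis_closed by (intro G.generate_is_subgroup) auto
  obtain v p where vp: "x = (v, p)" by (cases x)
  have v: "v \<in> V" "p \<in> carrier Q" using less.prems vp by (auto simp: tree_vertices_def)
  interpret h: group_hom "Gv v" G "conj_vertex x"
    unfolding vp using conj_vertex_hom[OF v] vertex_group[OF v(1)] G.is_group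
    by (simp add: group_hom_def group_hom_axioms_def)
  have bas: "conj_vertex x b \<in> ?L" if "b \<in> basis x" for b
    using less.prems(1) that
    by (intro generate.incl) (auto simp: kernel_basis_def Z_def intro!: image_eqI[of _ _ "(x, b)"])
  obtain B where B: "free_basis (Gv v) B" "conj_vertex x ` B \<subseteq> ?L"
  proof (cases "x = root")
    case True
    then have "v = v0" "basis x = B0" using vp by (auto simp: root_def basis_def)
    then show ?thesis using that root_basis bas by auto
  next
    case False
    then have x: "x \<in> tree_vertices - {root}" using less.prems by simp
    let ?l = "parent_letter x"
    note props = parent_letter_props[of v p, folded vp, OF x]
    have "conj_vertex x (tmap ?l a) \<in> ?L" if "a \<in> BE (fst ?l)" for a
    proof -
      have a: "a \<in> carrier (Ge (fst ?l))"
        using edge_basis[OF props(1)] that by (auto simp: free_basis_def)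
      then have "smap ?l a \<in> carrier (Gv (fst (parent x)))"
        using letter_maps(1)[OF props(1)] unfolding props(5) by (rule hom_in_carrier[rotated])
      then show ?thesis
        using less.IH[OF props(4,3)] conj_vertex_parent[OF x a] by simp
    qed
    moreover have "basis x = BK ?l" using False by (simp add: basis_def)
    ultimately show ?thesis
      using that[OF split_basis[OF props(1), unfolded props(2)]] bas by auto
  qed
  then have "conj_vertex x ` generate (Gv v) B \<subseteq> ?L"
    using L by (intro h.hom_generate_subset) (auto simp: free_basis_def)
  then show ?case
    using B less.prems vp by (auto simp: free_basis_def)
qed

text \<open>For the harder inclusion an element of the kernel is rewritten generator by generator
  with the transversal \<open>sec\<close>. Vertex generators contribute elements of conjugated
  vertex groups, edge generators contribute nothing.\<close>

lemma generate_kernel_basis: "generate G (kernel_basis ` Z) = kernel G Q \<kappa>"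
proof
  let ?L = "generate G (kernel_basis ` Z)"
  have L: "subgroup ?L G" using kernel_basis_closed by (intro G.generate_is_subgroup) auto
  have "kernel_basis ` Z \<subseteq> kernel G Q \<kappa>"
  proof
    fix y assume "y \<in> kernel_basis ` Z"
    then obtain v p b where y: "y = conj_vertex (v, p) b" "(v, p) \<in> tree_vertices" "b \<in> basis (v, p)"
      by (auto simp: kernel_basis_def Z_def)
    then have "v \<in> V" "p \<in> carrier Q" "b \<in> carrier (Gv v)"
      using basis_closed by (auto simp: tree_vertices_def)
    then show "y \<in> kernel G Q \<kappa>"
      by (simp add: y kernel_def conj_vertex_closed)
        (simp add: conj_vertex_def \<kappa>_sec \<kappa>_vertex)
  qed
  then show "?L \<subseteq> kernel G Q \<kappa>"
    by (rule G.generate_subgroup_incl[OF _ \<kappa>.subgroup_kernel])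
  \<comment> \<open>The correction factor returns each step to the kernel. A product obeys \<open>c
    p (g \<otimes> h) = c p g \<otimes> c (p \<otimes> \<kappa> g) h\<close>, and
    \<open>c \<one> g = g\<close> whenever \<open>\<kappa> g = \<one>\<close>.\<close>
  define c where "c p g = sec p \<otimes>\<^bsub>G\<^esub> g \<otimes>\<^bsub>G\<^esub> inv\<^bsub>G\<^esub> sec (p \<otimes>\<^bsub>Q\<^esub> \<kappa> g)" for p g
  have c_gen: "c p (gen x) \<in> ?L" if "x \<in> gens" "p \<in> carrier Q" for p x
  proof (cases x)
    case (Inl vg)
    then obtain v g where "x = Inl (v, g)" "v \<in> V" "g \<in> carrier (Gv v)" using \<open>x \<in> gens\<close> by (cases vg) auto
    then show ?thesis
      using conj_vertex_generated[of "(v, p)" g] that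
      by (simp add: c_def conj_vertex_def \<kappa>_vertex tree_vertices_def)
  next
    case (Inr e)
    then have e: "e \<in> E" "x = Inr e" using \<open>x \<in> gens\<close> by auto
    then have "c p (gen x) = \<one>\<^bsub>G\<^esub>"
      using that by (simp add: c_def \<kappa>_edge sec_edge_word)
    then show ?thesis by (simp add: generate.one)
  qed
  have cancel: "inv\<^bsub>G\<^esub> sec q \<otimes>\<^bsub>G\<^esub> (sec q \<otimes>\<^bsub>G\<^esub> y) = y" if "q \<in> carrier Q" "y \<in> carrier G" for q y
    using that by (simp flip: G.m_assoc)
  have "c p g \<in> ?L" if "g \<in> generate G (gen ` gens)" "p \<in> carrier Q" for p g
    using that
  proof (induction arbitrary: p)
    case one
    then show ?case by (simp add: c_def generate.one)
  next
    case (incl g)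
    then show ?case using c_gen by auto
  next
    case (inv g)
    then have g: "g \<in> carrier G" by auto
    \<comment> \<open>Reading \<open>g\<close> from \<open>?p\<close> ends at \<open>p\<close>, so
      the inverse letter retraces that step.\<close>
    let ?p = "p \<otimes>\<^bsub>Q\<^esub> inv\<^bsub>Q\<^esub> \<kappa> g"
    have "c p (inv\<^bsub>G\<^esub> g) = inv\<^bsub>G\<^esub> c ?p g"
      using g inv by (simp add: c_def G.inv_mult_group G.m_assoc Q.m_assoc)
    moreover have "c ?p g \<in> ?L" using c_gen inv g by auto
    ultimately show ?case using subgroup.m_inv_closed[OF L] by simp
  next
    case (eng g h)
    then have gh: "g \<in> carrier G" "h \<in> carrier G" unfolding generate_gen by auto
    have "c p (g \<otimes>\<^bsub>G\<^esub> h) = c p g \<otimes>\<^bsub>G\<^esub> c (p \<otimes>\<^bsub>Q\<^esub> \<kappa> g) h"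
      using gh eng.prems cancel[of "p \<otimes>\<^bsub>Q\<^esub> \<kappa> g"]
      by (simp add: c_def G.m_assoc Q.m_assoc del: sec.hom_mult)
    then show ?case
      using eng.IH(1)[OF eng.prems] eng.IH(2)[of "p \<otimes>\<^bsub>Q\<^esub> \<kappa> g"] gh eng.prems generate.eng by simp
  qed
  then have c_L: "c \<one>\<^bsub>Q\<^esub> g \<in> ?L" if "g \<in> carrier G" for g using that by (simp add: generate_gen)
  show "kernel G Q \<kappa> \<subseteq> ?L"
  proof
    fix g assume "g \<in> kernel G Q \<kappa>"
    then show "g \<in> ?L" using c_L[of g] by (simp add: kernel_def c_def)
  qed
qed

lemma is_free_group_kernel: "is_free_group (G\<lparr>carrier := kernel G Q \<kappa>\<rparr>)"
proof -
  let ?N = "kernel G Q \<kappa>"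
  have N: "subgroup ?N G" by (rule \<kappa>.subgroup_kernel)
  interpret N: group "G\<lparr>carrier := ?N\<rparr>" by (rule G.subgroup_imp_group[OF N])
  have sub: "kernel_basis ` Z \<subseteq> ?N"
    using generate_kernel_basis generate.incl[of _ "kernel_basis ` Z" G] by blast
  have "free_basis (G\<lparr>carrier := ?N\<rparr>) (kernel_basis ` Z)"
  proof (rule N.free_basis_image)
    show "generate (G\<lparr>carrier := ?N\<rparr>) (kernel_basis ` Z) = carrier (G\<lparr>carrier := ?N\<rparr>)"
      using generate_kernel_basis by (simp add: G.generate_consistent[OF sub N])
    fix w assume w: "reduced_word w" "w \<noteq> []" "fst ` set w \<subseteq> Z"
    have "lift_word (G\<lparr>carrier := ?N\<rparr>) kernel_basis w = lift_word G kernel_basis w"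
      unfolding lift_word_def using sub w
      by (intro G.eval_word_subgroup[OF N]) (fastforce simp: image_subset_iff)
    then show "lift_word (G\<lparr>carrier := ?N\<rparr>) kernel_basis w \<noteq> \<one>\<^bsub>G\<lparr>carrier := ?N\<rparr>\<^esub>"
      using kernel_basis_free[OF w] by simp
  qed (use sub in auto)
  then show ?thesis by (auto simp: is_free_group_def N.is_group)
qed

section \<open>The chain of normal subgroups\<close>

lemma normally_poly_free_G: "normally_poly_free G"
proof -
  let ?N = "kernel G Q \<kappa>"
  interpret Nn: normal ?N G by (rule \<kappa>.normal_kernel)
  have N: "subgroup ?N G" by (rule \<kappa>.subgroup_kernel)
  interpret N: group "G\<lparr>carrier := ?N\<rparr>" by (rule G.subgroup_imp_group[OF N])
  \<comment> \<open>Surjectivity is witnessed by \<open>sec\<close>, so the quotient by the kernel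
    is a copy of the free group \<open>Q\<close>.\<close>
  have "\<kappa> ` carrier G = carrier Q"
    using \<kappa>_sec sec.hom_closed \<kappa>.hom_closed by (metis image_subsetI image_eqI subset_antisym subsetI)
  then have "(\<lambda>C. the_elem (\<kappa> ` C)) \<in> iso (G Mod ?N) Q" by (rule \<kappa>.FactGroup_iso_set)
  then have "inv_into (carrier (G Mod ?N)) (\<lambda>C. the_elem (\<kappa> ` C)) \<in> iso Q (G Mod ?N)"
    by (rule group.iso_set_sym[OF Nn.factorgroup_is_group])
  moreover have "is_free_group Q"
    using free_basis_free_group_on Q.is_group by (auto simp: is_free_group_def)
  ultimately have quotient: "is_free_group (G Mod ?N)"
    using is_free_group_iso Q.is_group Nn.factorgroup_is_group by blast
  have "normal {\<one>\<^bsub>G\<^esub>} (G\<lparr>carrier := ?N\<rparr>)" using N.one_is_normal by simp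
  moreover have "is_free_group ((G\<lparr>carrier := ?N\<rparr>) Mod {\<one>\<^bsub>G\<^esub>})"
  proof -
    have grp: "group ((G\<lparr>carrier := ?N\<rparr>) Mod {\<one>\<^bsub>G\<^esub>})"
      using normal.factorgroup_is_group[OF N.one_is_normal] by simp
    have "the_elem \<in> iso ((G\<lparr>carrier := ?N\<rparr>) Mod {\<one>\<^bsub>G\<^esub>}) (G\<lparr>carrier := ?N\<rparr>)"
      using N.trivial_factor_iso by simp
    from group.iso_set_sym[OF grp this] show ?thesis
      using is_free_group_iso[OF N.is_group grp] is_free_group_kernel by blast
  qed
  moreover have "G\<lparr>carrier := carrier G\<rparr> = G" by simp
  ultimately show ?thesis
    unfolding normally_poly_free_def using quotient G.one_is_normal Nn.normal_axioms G.normal_self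
    by (intro conjI G.is_group
        exI[of _ "\<lambda>i :: nat. if i = 0 then {\<one>\<^bsub>G\<^esub>} else if i = 1 then ?N else carrier G"] exI[of _ 2])
      (auto simp: less_2_cases_iff)
qed

end

theorem theorem1p3:
  fixes V :: "'v set" and E :: "'e set" and o' t :: "'e \<Rightarrow> 'v"
    and Gv :: "'v \<Rightarrow> 'a monoid" and Ge :: "'e \<Rightarrow> 'b monoid"
    and \<alpha> \<omega> :: "'e \<Rightarrow> 'b \<Rightarrow> 'a" and T :: "'e set"
  assumes "alg_clean_graph_of_free_groups V E o' t Gv Ge \<alpha> \<omega>"
    and "spanning_tree V E o' t T"
  shows "normally_poly_free (gog_fundamental_group V E o' t Gv Ge \<alpha> \<omega> T)"
proof -
  interpret clean_graph_of_groups V E o' t Gv Ge \<alpha> \<omega> T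
    using assms by unfold_locales
  \<comment> \<open>The equation \<open>card T + 1 = card V\<close> rules out the empty graph and so
    provides a vertex for the root.\<close>
  have "card V > 0" using tree by (simp add: spanning_tree_def)
  then obtain v0 where v0: "v0 \<in> V" by (auto simp: card_gt_0_iff)
  obtain B0 where B0: "free_basis (Gv v0) B0"
    using clean v0 by (auto simp: alg_clean_graph_of_free_groups_def is_fin_rank_free_group_def)
  have "\<forall>e. \<exists>B. e \<in> E \<longrightarrow> free_basis (Ge e) B"
    using clean by (auto simp: alg_clean_graph_of_free_groups_def is_fin_rank_free_group_def)
  then obtain BE where BE: "\<And>e. e \<in> E \<Longrightarrow> free_basis (Ge e) (BE e)" by metis
  have "\<forall>l. \<exists>B. fst l \<in> E \<longrightarrow>
      free_basis (Gv (tgt l)) (tmap l ` BE (fst l) \<union> B) \<and> tmap l ` BE (fst l) \<inter> B = {}"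
    using ex_split_basis BE by blast
  then obtain BK where BK: "\<And>l. fst l \<in> E \<Longrightarrow>
      free_basis (Gv (tgt l)) (tmap l ` BE (fst l) \<union> BK l) \<and> tmap l ` BE (fst l) \<inter> BK l = {}" by metis
  \<comment> \<open>Parents are chosen for every root \<open>r\<close>, since different copies of
    the spanning tree may be entered at different vertices.\<close>
  have "\<forall>r. \<exists>(d :: 'v \<Rightarrow> nat) f. r \<in> V \<longrightarrow>
    (\<forall>v\<in>V - {r}. fst (f v) \<in> T \<and> tgt (f v) = v \<and> src (f v) \<in> V \<and> d (src (f v)) < d v) \<and>
    (\<forall>e\<in>T. \<exists>b. tgt (e, b) \<in> V - {r} \<and> f (tgt (e, b)) = (e, b))"
    using spanning_tree_parents[OF tree fin ends] unfolding src_def tgt_def by blast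
  then obtain d :: "'v \<Rightarrow> 'v \<Rightarrow> nat" and f where df: "\<And>r. r \<in> V \<Longrightarrow>
    (\<forall>v\<in>V - {r}. fst (f r v) \<in> T \<and> tgt (f r v) = v \<and> src (f r v) \<in> V \<and> d r (src (f r v)) < d r v) \<and>
    (\<forall>e\<in>T. \<exists>b. tgt (e, b) \<in> V - {r} \<and> f r (tgt (e, b)) = (e, b))"
    by metis
  obtain \<kappa> where \<kappa>: "\<kappa> \<in> hom G Q" "\<And>v g. \<lbrakk>v \<in> V; g \<in> carrier (Gv v)\<rbrakk> \<Longrightarrow> \<kappa> (gen (Inl (v, g))) = \<one>\<^bsub>Q\<^esub>"
    "\<And>e. e \<in> E \<Longrightarrow> \<kappa> (gen (Inr e)) = edge_word e"
    using ex_retraction by blast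
  interpret split_graph_of_groups V E o' t Gv Ge \<alpha> \<omega> T v0 d f B0 BE BK \<kappa>
    using v0 df B0 BE BK \<kappa> by unfold_locales blast+
  show ?thesis by (rule normally_poly_free_G)
qed

end
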